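(* Let $\mu$ be a directed metric on a finite set $S$, and let $\mu^t$ be its transpose, $\mu^t(x,y)=\mu(y,x)$. The following conditions are equivalent: (a) $\mu$ is a directed tree metric. (b) $\mu$ is congruent to a tree metric. (c) $\mu+\mu^t$ satisfies the four point condition, and $\mu(x,y)+\mu(y,z)+\mu(z,x)=\mu(z,y)+\mu(y,x)+\mu(x,z)$ holds for every triple $x,y,z\in S$. (d) The tropical rank of $-\mu$ is at most $2$.
   Context: A directed metric on a set $S$ is a function $\mu:S\times S\to\mathbf{R}_+$ (nonnegative reals) with $\mu(x,x)=0$ and $\mu(x,y)+\mu(y,z)\ge\mu(x,z)$ for all $x,y,z$; it need not be symmetric, and $\mu(x,y)=0$ is allowed for $x\ne y$. Directed tree metric: an oriented tree is a (finite) directed graph whose underlying undirected graph is a tree. For an oriented tree $\Gamma$ with vertex set $V\Gamma$, edge set $E\Gamma$ and edge-length $\alpha:E\Gamma\to\mathbf{R}_+$, and $x,y\in V\Gamma$, let $\vec P[x,y]$ be the set of those edges on the unique path between $x$ and $y$ in the underlying undirected tree whose direction agrees with the direction from $x$ to $y$, and set $D_{\Gamma,\alpha}(x,y)=\sum_{e\in\vec P[x,y]}\alpha(e)$. $\mu$ is a directed tree metric if there are an oriented tree $\Gamma$, a positive edge-length $\alpha$ and vertices $v_s\in V\Gamma$ $(s\in S)$, not necessarily distinct, with $\mu(s,t)=D_{\Gamma,\alpha}(v_s,v_t)$ for all $s,t\in S$. Tree metric: a (symmetric) metric $d$ on $S$ that can be represented as the graph metric of some tree, i.e. there are an undirected (finite)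 tree with positive edge-lengths and vertices $v_s$ $(s\in S)$, not necessarily distinct, such that $d(s,t)$ is the length of the path between $v_s$ and $v_t$ for all $s,t\in S$. Congruence: for a cycle $C=(p_1,\dots,p_m)$, a cyclic sequence of (possibly repeated) points of $S$, $d(C)=d(p_1,p_2)+\dots+d(p_{m-1},p_m)+d(p_m,p_1)$. Two directed metrics $d,d'$ on $S$ are congruent if $d(C)=d'(C)$ for every cycle $C$ in $S$. Four point condition for $\nu$ on $S$: $\nu(s,t)+\nu(u,v)\le\max\{\nu(s,u)+\nu(t,v),\nu(s,v)+\nu(t,u)\}$ for all $s,t,u,v\in S$. Tropical rank of $-\mu$: let $S^c,S^r$ be two disjoint copies of $S$ (with $s^c,s^r$ the copies of $s$). The tropical rank is the maximum integer $n$ such that there exist $n$-element subsets $A^c\subseteq S^c$, $B^r\subseteq S^r$ for which the maximum of $\mu(M)=\sum_{a^cb^r\in M}\mu(a,b)$ over perfect matchings $M$ of the complete bipartite graph with bipartition $(A^c,B^r)$ is attained by a unique $M$. *)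

theory Defs
  imports Complex_Main "Graph_Theory.Digraph_Component"
begin

section \<open>Directed metrics on a carrier set\<close>

definition directed_metric_on :: "'a set \<Rightarrow> ('a \<Rightarrow> 'a \<Rightarrow> real) \<Rightarrow> bool" where
  "directed_metric_on S \<mu> \<longleftrightarrow>
     (\<forall>x\<in>S. \<forall>y\<in>S. \<mu> x y \<ge> 0) \<and>
     (\<forall>x\<in>S. \<mu> x x = 0) \<and>
     (\<forall>x\<in>S. \<forall>y\<in>S. \<forall>z\<in>S. \<mu> x y + \<mu> y z \<ge> \<mu> x z)"

text \<open>As for directed metrics, distinct points are allowed to be at distance zero.\<close>

definition metric_on :: "'a set \<Rightarrow> ('a \<Rightarrow> 'a \<Rightarrow> real) \<Rightarrow> bool" where
  "metric_on S d \<longleftrightarrow> directed_metric_on S d \<and> (\<forall>x\<in>S. \<forall>y\<in>S. d x y = d y x)"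

definition transp_fun :: "('a \<Rightarrow> 'a \<Rightarrow> real) \<Rightarrow> 'a \<Rightarrow> 'a \<Rightarrow> real" where
  "transp_fun \<mu> x y = \<mu> y x"

text \<open>A cycle is a nonempty list of points, read cyclically; a single point \<open>[p]\<close> contributes
  \<open>d p p\<close>.\<close>

definition cycle_sum :: "('a \<Rightarrow> 'a \<Rightarrow> real) \<Rightarrow> 'a list \<Rightarrow> real" where
  "cycle_sum d C = (\<Sum>(p, q) \<leftarrow> zip C (rotate1 C). d p q)"

definition congruent_on :: "'a set \<Rightarrow> ('a \<Rightarrow> 'a \<Rightarrow> real) \<Rightarrow> ('a \<Rightarrow> 'a \<Rightarrow> real) \<Rightarrow> bool" where
  "congruent_on S d d' \<longleftrightarrow>
     (\<forall>C. C \<noteq> [] \<and> set C \<subseteq> S \<longrightarrow> cycle_sum d C = cycle_sum d' C)"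

definition four_point_on :: "'a set \<Rightarrow> ('a \<Rightarrow> 'a \<Rightarrow> real) \<Rightarrow> bool" where
  "four_point_on S \<nu> \<longleftrightarrow>
     (\<forall>s\<in>S. \<forall>t\<in>S. \<forall>u\<in>S. \<forall>v\<in>S. \<nu> s t + \<nu> u v \<le> max (\<nu> s u + \<nu> t v) (\<nu> s v + \<nu> t u))"


section \<open>Undirected and oriented trees\<close>

text \<open>An undirected simple graph is a symmetric digraph without loops and parallel arcs
  (locale \<open>pair_graph\<close>). There, every edge gives rise to a directed cycle of length two, so
  undirected cycles are the cycles with at least three arcs. The constant \<open>tree\<close> of the library
  forbids directed cycles only, and hence does not describe trees in the present sense.\<close>

definition undirected_tree :: "'v pair_pre_digraph \<Rightarrow> bool" where
  "undirected_tree T \<longleftrightarrow>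
     pair_graph T \<and> connected T \<and> \<not> (\<exists>p. pre_digraph.cycle T p \<and> length p \<ge> 3)"

text \<open>Passing to the symmetric closure would merge a pair of antiparallel arcs, which form a
  cycle in the underlying undirected graph; they are therefore excluded separately.\<close>

definition oriented_tree :: "'v pair_pre_digraph \<Rightarrow> bool" where
  "oriented_tree \<Gamma> \<longleftrightarrow>
     pair_digraph \<Gamma> \<and> antisym (parcs \<Gamma>) \<and> undirected_tree (mk_symmetric \<Gamma>)"

text \<open>The arcs of the unique path in an undirected tree, each directed from \<open>x\<close> towards \<open>y\<close>.\<close>

definition tree_path :: "'v pair_pre_digraph \<Rightarrow> 'v \<Rightarrow> 'v \<Rightarrow> ('v \<times> 'v) list" where
  "tree_path T x y = (THE p. pre_digraph.apath T x p y)"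

definition tree_dist :: "'v pair_pre_digraph \<Rightarrow> ('v set \<Rightarrow> real) \<Rightarrow> 'v \<Rightarrow> 'v \<Rightarrow> real" where
  "tree_dist T \<alpha> x y = (\<Sum>(u, v) \<in> set (tree_path T x y). \<alpha> {u, v})"

definition forward_arcs :: "'v pair_pre_digraph \<Rightarrow> 'v \<Rightarrow> 'v \<Rightarrow> ('v \<times> 'v) set" where
  "forward_arcs \<Gamma> x y = {e \<in> parcs \<Gamma>. e \<in> set (tree_path (mk_symmetric \<Gamma>) x y)}"

definition directed_tree_dist ::
    "'v pair_pre_digraph \<Rightarrow> ('v \<times> 'v \<Rightarrow> real) \<Rightarrow> 'v \<Rightarrow> 'v \<Rightarrow> real" where
  "directed_tree_dist \<Gamma> \<alpha> x y = (\<Sum>e \<in> forward_arcs \<Gamma> x y. \<alpha> e)"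

text \<open>Trees are finite, so taking natural numbers as vertices is no restriction.\<close>

definition directed_tree_metric_on :: "'a set \<Rightarrow> ('a \<Rightarrow> 'a \<Rightarrow> real) \<Rightarrow> bool" where
  "directed_tree_metric_on S \<mu> \<longleftrightarrow>
     (\<exists>(\<Gamma> :: nat pair_pre_digraph) \<alpha> v.
        oriented_tree \<Gamma> \<and> (\<forall>e\<in>parcs \<Gamma>. \<alpha> e > 0) \<and> v ` S \<subseteq> pverts \<Gamma> \<and>
        (\<forall>s\<in>S. \<forall>t\<in>S. \<mu> s t = directed_tree_dist \<Gamma> \<alpha> (v s) (v t)))"

definition tree_metric_on :: "'a set \<Rightarrow> ('a \<Rightarrow> 'a \<Rightarrow> real) \<Rightarrow> bool" where
  "tree_metric_on S d \<longleftrightarrow> metric_on S d \<and>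
     (\<exists>(T :: nat pair_pre_digraph) \<alpha> v.
        undirected_tree T \<and> (\<forall>(x, y)\<in>parcs T. \<alpha> {x, y} > 0) \<and> v ` S \<subseteq> pverts T \<and>
        (\<forall>s\<in>S. \<forall>t\<in>S. d s t = tree_dist T \<alpha> (v s) (v t)))"


section \<open>Tropical rank\<close>

text \<open>A pair \<open>(a, b)\<close> stands for the edge between the copy of \<open>a\<close> in the first and the copy of
  \<open>b\<close> in the second colour class, so \<open>A\<close> and \<open>B\<close> may overlap as subsets of \<open>S\<close>.\<close>

definition perfect_matching :: "'a set \<Rightarrow> 'a set \<Rightarrow> ('a \<times> 'a) set \<Rightarrow> bool" where
  "perfect_matching A B M \<longleftrightarrow>
     M \<subseteq> A \<times> B \<and> (\<forall>a\<in>A. \<exists>!b. (a, b) \<in> M) \<and> (\<forall>b\<in>B. \<exists>!a. (a, b) \<in> M)"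

definition matching_weight :: "('a \<Rightarrow> 'a \<Rightarrow> real) \<Rightarrow> ('a \<times> 'a) set \<Rightarrow> real" where
  "matching_weight \<mu> M = (\<Sum>(a, b)\<in>M. \<mu> a b)"

text \<open>The tropical rank of the negated matrix \<open>- \<mu>\<close>, whence the maximum. The set below contains
  \<open>0\<close> and is bounded by the cardinality of \<open>S\<close> if \<open>S\<close> is finite.\<close>

definition tropical_rank_uminus :: "'a set \<Rightarrow> ('a \<Rightarrow> 'a \<Rightarrow> real) \<Rightarrow> nat" where
  "tropical_rank_uminus S \<mu> =
     Max {n. \<exists>A B. A \<subseteq> S \<and> B \<subseteq> S \<and> card A = n \<and> card B = n \<and>
               (\<exists>!M. is_arg_max (matching_weight \<mu>) (perfect_matching A B) M)}"

end

theory Submission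
  imports Defs
begin

text \<open>
  All four conditions say that \<open>\<mu>\<close> is a tree metric plus a potential difference. Put
  \<open>d = (\<mu> + \<mu>\<^sup>t) / 2\<close>. The identity for triples in the third condition is the cocycle condition for the
  antisymmetric part of \<open>\<mu>\<close>, so it provides a potential \<open>\<pi>\<close> with
  \<open>\<mu> x y = d x y + \<pi> y - \<pi> x\<close> (lemma \<open>cyclic_symmetric_potential\<close>). Potential differences
  telescope along cycles, so \<open>\<mu>\<close> is congruent to \<open>d\<close>; and they add the same constant to all perfect
  matchings between two given classes, so \<open>\<mu>\<close> and \<open>d\<close> have the same uniquely optimal matchings.

  Trees satisfy the third condition. Any three vertices of a tree have a median, which lies on
  all three paths between them. Splitting the paths there gives the identity for triples for arbitrary
  weights of the arcs (\<open>arc_dist_cyclic\<close>), and comparing the projections of two vertices to the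
  path between two others gives the four point condition (\<open>arc_dist_four_point\<close>). A directed tree
  metric is the case where one of the two arcs of each edge has weight zero, a tree metric
  the case of symmetric weights.

  Conversely, let \<open>d\<close> satisfy the four point condition. Seen from a root \<open>r\<close>, the points of \<open>S\<close> are the
  leaves of a bundle of branches: \<open>x\<close> and \<open>y\<close> run together up to the height given by their Gromov
  product \<open>g x y = (d r x + d r y - d x y) / 2\<close>. The four point condition makes \<open>g\<close> an
  ultrametric similarity, so the branches form a tree. Its leaves and branching points are
  among the finitely many \<open>(x, g x y)\<close>; in order of increasing height, these are attached one after
  another to their highest ancestor
  (\<open>realizable_on_branch_closed\<close>). Since \<open>\<mu> \<ge> 0\<close>, the potential \<open>\<pi>\<close> is 1-Lipschitz for \<open>d\<close> and extends to
  the branching points with this property (\<open>lipschitz_extension\<close>), so \<open>\<mu>\<close> itself extends to a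
  nonnegative function on them. An edge whose two directions have the lengths \<open>a\<close> and \<open>b\<close> is then made
  of one arc of length \<open>a\<close> in the first direction, followed by an opposite arc of length \<open>b\<close>, where
  lengths zero are left out. With \<open>\<pi> = 0\<close> the same construction represents \<open>d\<close>.

  For the tropical rank, a uniquely optimal matching of size at least three restricts to one of
  size three, and the latter means five strict inequalities between sums of three
  distances. If \<open>\<mu>\<close> violates the identity for triples or the four point condition, suitable points yield
  these inequalities (\<open>four_point_cyclic_if_tropical_rank_le_2\<close>). If \<open>\<mu>\<close> satisfies both, they contradict the
  ultrametric inequality of the Gromov product, with one of the six points as the root
  (\<open>four_point_imp_not_uniquely_maximal3\<close>).
\<close>

section \<open>Paths and medians in trees\<close>

lemma pair_sym_digraph_connected_conv:
  assumes "pair_sym_digraph G"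
  shows "connected (with_proj G) \<longleftrightarrow> strongly_connected (with_proj G)"
proof -
  interpret pair_sym_digraph G by fact
  have "parcs (mk_symmetric (with_proj G)) = parcs G"
    by (auto simp: parcs_mk_symmetric intro: arcs_symmetric)
  then have "mk_symmetric (with_proj G) = G" by (simp add: mk_symmetric_def)
  then show ?thesis by (simp add: connected_def)
qed

locale tree_graph = pair_graph G for G :: "'v pair_pre_digraph" +
  assumes tree_connected: "connected (with_proj G)"
    and tree_acyclic: "cycle p \<Longrightarrow> length p < 3"

lemma undirected_tree_iff: "undirected_tree T \<longleftrightarrow> tree_graph T"
  unfolding undirected_tree_def tree_graph_def tree_graph_axioms_def
  by (auto simp: not_less[symmetric])

context tree_graph
begin

lemma apath_ex:
  assumes "u \<in> pverts G" "v \<in> pverts G"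
  shows "\<exists>p. apath u p v"
proof -
  have "strongly_connected (with_proj G)"
    using tree_connected pair_sym_digraph_connected_conv[of G]
    by (simp add: pair_sym_digraph_axioms)
  then show ?thesis
    using assms by (auto simp: strongly_connected_def reachable_apath)
qed

text \<open>
  At the first vertex where two different paths between the same vertices separate, their remaining parts
  form a walk between two distinct neighbours of that vertex which avoids it. Hence the vertex lies on a
  cycle of length at least three.
\<close>

lemma apath_unique:
  assumes "apath u p v" "apath u q v"
  shows "p = q"
  using assms
proof (induction p arbitrary: u q)
  case Nil
  then have "u = v" by (simp add: apath_Nil_iff)
  with Nil show ?case using apath_nonempty_ends by blast
next
  case (Cons e p)
  then have "u \<noteq> v" using apath_nonempty_ends by blast
  with Cons.prems obtain f q' where q: "q = f # q'"
    by (cases q) (auto simp: apath_Nil_iff)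
  obtain a b where e: "e = (u,a)" and f: "f = (u,b)"
    using Cons.prems q by (cases e, cases f) (auto simp: apath_Cons_iff)
  have p: "(u,a) \<in> parcs G" "apath a p v" "u \<notin> set (pawalk_verts a p)"
    and q': "(u,b) \<in> parcs G" "apath b q' v" "u \<notin> set (pawalk_verts b q')"
    using Cons.prems by (auto simp: q e f apath_Cons_iff)
  show ?case
  proof (cases "a = b")
    case True
    with Cons.IH p q' show ?thesis by (simp add: q e f)
  next
    case False
    have w1: "awalk a p v" "awalk v (rev_path q') b"
      using p q' by (auto simp: apath_def)
    then have w: "awalk a (p @ rev_path q') b" by (rule awalk_appendI)
    define r where "r = awalk_to_apath (p @ rev_path q')"
    have r: "apath a r b" unfolding r_def using w by (rule apath_awalk_to_apath)
    have rsub: "set r \<subseteq> set (p @ rev_path q')"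
      unfolding r_def using w by (rule awalk_to_apath_subset)
    have "set (pawalk_verts a r) \<subseteq> set (pawalk_verts a (p @ rev_path q'))"
      using set_awalk_verts[of a r b] set_awalk_verts[OF w] r rsub by (auto simp: apath_def)
    also have "\<dots> = set (pawalk_verts a p) \<union> set (pawalk_verts b q')"
      using set_awalk_verts_append[OF w1] awalk_verts_rev_path[of b q' v] q'
      by (simp add: apath_def)
    finally have u: "u \<notin> set (pawalk_verts a r)" using p q' by auto
    have "awalk b [(b,u)] u"
      using q'(1) by (auto simp: awalk_simps intro: arcs_symmetric wellformed')
    then have rw: "awalk a (r @ [(b,u)]) u"
      using r by (intro awalk_appendI) (auto simp: apath_def)
    then have cw: "awalk u ((u,a) # r @ [(b,u)]) u"
      using p(1) unfolding awalk_Cons_iff by (simp only: fst_conv snd_conv simp_thms)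
    have "pawalk_verts a (r @ [(b,u)]) = pawalk_verts a r @ [u]"
      using awalk_verts_append[OF rw] by simp
    then have "cycle ((u,a) # r @ [(b,u)])"
      unfolding cycle_def using cw u r by (intro exI[of _ u]) (auto simp: apath_def)
    moreover have "r \<noteq> []" using r False by (auto simp: apath_Nil_iff)
    ultimately show ?thesis using tree_acyclic by (fastforce simp: Suc_le_eq)
  qed
qed

lemma tree_path_eqI: "apath x p y \<Longrightarrow> tree_path G x y = p"
  unfolding tree_path_def by (rule the_equality) (auto intro: apath_unique)

lemma apath_tree_path:
  assumes "x \<in> pverts G" "y \<in> pverts G"
  shows "apath x (tree_path G x y) y"
  using apath_ex[OF assms] tree_path_eqI by metis

text \<open>
  The vertex \<open>m\<close> lies on the path from \<open>x\<close> to \<open>y\<close>. Defining this by concatenation makes every function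
  that sums weights along paths additive at \<open>m\<close>.
\<close>

definition between :: "'v \<Rightarrow> 'v \<Rightarrow> 'v \<Rightarrow> bool" where
  "between x m y \<longleftrightarrow> m \<in> pverts G \<and> tree_path G x y = tree_path G x m @ tree_path G m y"

lemma betweenI:
  assumes "apath x (p @ q) y" "awalk x p m"
  shows "between x m y"
proof -
  have m: "awlast x p = m" using assms(2) by auto
  then have "apath x p m" "apath m q y"
    using assms(1) by (auto simp: apath_append_iff)
  then show ?thesis using assms tree_path_eqI
    unfolding between_def by (metis awalk_last_in_verts)
qed

lemma between_if_on_path:
  assumes "x \<in> pverts G" "y \<in> pverts G" "m \<in> set (pawalk_verts x (tree_path G x y))"
  shows "between x m y"
proof -
  have ap: "apath x (tree_path G x y) y" using assms by (intro apath_tree_path)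
  then obtain q r where "tree_path G x y = q @ r" "awalk x q m"
    using awalk_decomp assms(3) unfolding apath_def by blast
  then show ?thesis using ap by (intro betweenI[of x q r]) auto
qed

lemma between_sym:
  assumes "x \<in> pverts G" "y \<in> pverts G" "between x m y"
  shows "between y m x"
proof -
  have m: "m \<in> pverts G" using assms by (simp add: between_def)
  have "apath y (rev_path (tree_path G m y) @ rev_path (tree_path G x m)) x"
    using apath_tree_path[OF assms(1,2)] assms(3)
    by (metis apath_rev_path between_def rev_path_append)
  moreover have "awalk y (rev_path (tree_path G m y)) m"
    using apath_tree_path[OF m assms(2)] by (simp add: apath_def)
  ultimately show ?thesis by (rule betweenI)
qed

text \<open>
  The projection is the first vertex of the path from \<open>z\<close> to \<open>x\<close> that lies on the path from \<open>x\<close> to \<open>y\<close>. Up to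
  it, the former path avoids the latter, so it can be continued to either end without repeating a vertex.
\<close>

lemma between_projection:
  assumes "x \<in> pverts G" "y \<in> pverts G" "z \<in> pverts G"
  obtains m where "m \<in> set (pawalk_verts x (tree_path G x y))" "between z m x" "between z m y"
proof -
  let ?P = "tree_path G x y" and ?R = "tree_path G z x"
  have P: "apath x ?P y" and R: "apath z ?R x"
    using assms by (auto intro: apath_tree_path)
  have "x \<in> set (pawalk_verts z ?R)"
  proof -
    have "last (pawalk_verts z ?R) = x" using R by (auto simp: apath_def)
    then show ?thesis using last_in_set[OF awalk_verts_non_Nil, of z ?R] by simp
  qed
  moreover have xP: "x \<in> set (pawalk_verts x ?P)"
    using P hd_in_awalk_verts by blast
  ultimately have "\<exists>m\<in>set (pawalk_verts z ?R). m \<in> set (pawalk_verts x ?P)" by blast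
  then obtain ys m zs where split: "pawalk_verts z ?R = ys @ m # zs"
      "m \<in> set (pawalk_verts x ?P)" "\<forall>y\<in>set ys. y \<notin> set (pawalk_verts x ?P)"
    using split_list_first_prop[of "pawalk_verts z ?R" "\<lambda>m. m \<in> set (pawalk_verts x ?P)"]
    by blast
  have cR: "pcas z ?R x" using R by (auto simp: apath_def)
  obtain R1 R2 where R12: "?R = R1 @ R2" "pcas z R1 m" "pawalk_verts z R1 = ys @ [m]"
    using awalk_decomp_verts[OF cR split(1)] by metis
  have bxy: "between x m y"
    using split(2) assms by (intro between_if_on_path) auto
  then have m: "m \<in> pverts G" and Peq: "?P = tree_path G x m @ tree_path G m y"
    by (auto simp: between_def)
  have aR: "apath z (R1 @ R2) x" using R R12 by simp
  then have R1: "apath z R1 m"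
    using R12(3) by (simp add: apath_append_iff)
  have xm: "apath x (tree_path G x m) m" and my: "apath m (tree_path G m y) y"
    using assms m by (auto intro: apath_tree_path)
  have "set (pawalk_verts m (tree_path G m y)) \<subseteq> set (pawalk_verts x ?P)"
    using set_awalk_verts_append[of x "tree_path G x m" m "tree_path G m y" y] xm my Peq
    by (auto simp: apath_def)
  moreover have "pawalk_verts m (tree_path G m y) = m # tl (pawalk_verts m (tree_path G m y))"
    using my by (cases "tree_path G m y") (auto simp: apath_Cons_iff)
  then have "set (pawalk_verts m (tree_path G m y)) = insert m (set (tl (pawalk_verts m (tree_path G m y))))"
    and "m \<notin> set (tl (pawalk_verts m (tree_path G m y)))"
    using my unfolding apath_def by (metis list.simps(15), metis distinct.simps(2))
  ultimately have "set (ys @ [m]) \<inter> set (tl (pawalk_verts m (tree_path G m y))) = {}"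
    using split(3) by auto
  then have "apath z (R1 @ tree_path G m y) y"
    using R1 my R12(3) by (simp add: apath_append_iff)
  then have "between z m y" using R1 by (intro betweenI) (auto simp: apath_def)
  moreover have "between z m x" using aR R1 by (intro betweenI) (auto simp: apath_def)
  ultimately show ?thesis using that split(2) by blast
qed

lemma median_ex:
  assumes "x \<in> pverts G" "y \<in> pverts G" "z \<in> pverts G"
  obtains m where "m \<in> pverts G" "between x m y" "between z m x" "between z m y"
proof -
  obtain m where "m \<in> set (pawalk_verts x (tree_path G x y))" "between z m x" "between z m y"
    using between_projection[OF assms] .
  moreover from this have "between x m y" using assms by (intro between_if_on_path)
  ultimately show ?thesis using that unfolding between_def by blast
qed

lemma between_linear:
  assumes "x \<in> pverts G" "y \<in> pverts G" "between x m y" "between x n y"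
  shows "between x n m \<or> between m n y"
proof -
  have m: "m \<in> pverts G" and n: "n \<in> pverts G" using assms by (auto simp: between_def)
  have P: "tree_path G x y = tree_path G x m @ tree_path G m y"
    and P': "tree_path G x y = tree_path G x n @ tree_path G n y"
    using assms by (auto simp: between_def)
  have a: "apath x (tree_path G x m) m" "apath m (tree_path G m y) y" 
    "apath x (tree_path G x n) n" "apath n (tree_path G n y) y"
    using assms m n by (auto intro: apath_tree_path)
  have "n \<in> set (pawalk_verts n (tree_path G n y))"
    using a hd_in_awalk_verts by blast
  then have "n \<in> set (pawalk_verts x (tree_path G x y))"
    using set_awalk_verts_append[of x "tree_path G x n" n "tree_path G n y" y] a P'
    by (auto simp: apath_def)
  then have "n \<in> set (pawalk_verts x (tree_path G x m)) \<or> n \<in> set (pawalk_verts m (tree_path G m y))"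
    using set_awalk_verts_append[of x "tree_path G x m" m "tree_path G m y" y] a P
    by (auto simp: apath_def)
  then show ?thesis using assms m between_if_on_path by blast
qed

end

text \<open>
  The two arcs of an edge may have different weights. This covers symmetric edge lengths as well as
  oriented trees, where one of the two arcs has weight zero.
\<close>

definition arc_dist :: "'v pair_pre_digraph \<Rightarrow> ('v \<times> 'v \<Rightarrow> real) \<Rightarrow> 'v \<Rightarrow> 'v \<Rightarrow> real" where
  "arc_dist T w x y = (\<Sum>e \<leftarrow> tree_path T x y. w e)"

context tree_graph
begin

lemma arc_dist_between:
  "between x m y \<Longrightarrow> arc_dist G w x y = arc_dist G w x m + arc_dist G w m y"
  by (simp add: arc_dist_def between_def)

lemma arc_dist_nonneg:
  assumes "x \<in> pverts G" "y \<in> pverts G" "\<And>e. e \<in> parcs G \<Longrightarrow> 0 \<le> w e"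
  shows "0 \<le> arc_dist G w x y"
proof -
  have "set (tree_path G x y) \<subseteq> parcs G"
    using apath_tree_path[OF assms(1,2)] by (auto simp: apath_def)
  then show ?thesis unfolding arc_dist_def
    using assms(3) by (intro sum_list_nonneg) auto
qed

lemma arc_dist_conv_sum:
  assumes "x \<in> pverts G" "y \<in> pverts G"
  shows "arc_dist G w x y = (\<Sum>e\<in>set (tree_path G x y). w e)"
proof -
  have "distinct (tree_path G x y)"
    using apath_tree_path[OF assms] distinct_verts_imp_distinct unfolding apath_def by blast
  then show ?thesis by (simp add: arc_dist_def sum_list_distinct_conv_sum_set)
qed

lemma arc_dist_triangle:
  assumes "x \<in> pverts G" "y \<in> pverts G" "z \<in> pverts G" "\<And>e. e \<in> parcs G \<Longrightarrow> 0 \<le> w e"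
  shows "arc_dist G w x z \<le> arc_dist G w x y + arc_dist G w y z"
proof -
  obtain m where m: "m \<in> pverts G" "between x m z" "between y m x" "between y m z"
    using median_ex[of x z y] assms by blast
  then have "between x m y" using assms between_sym by blast
  with m show ?thesis
    using arc_dist_nonneg[of y m w] arc_dist_nonneg[of m y w] assms
    by (simp add: arc_dist_between)
qed

text \<open>
  Both cyclic sums run through each of the three arms at the median once in either direction.
\<close>

lemma arc_dist_cyclic:
  assumes "x \<in> pverts G" "y \<in> pverts G" "z \<in> pverts G"
  shows "arc_dist G w x y + arc_dist G w y z + arc_dist G w z x =
    arc_dist G w z y + arc_dist G w y x + arc_dist G w x z"
proof -
  obtain m where m: "between x m y" "between z m x" "between z m y"
    using median_ex[OF assms] by blast
  then have "between y m x" "between x m z" "between y m z" using assms between_sym by blast+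
  with m show ?thesis by (simp add: arc_dist_between)
qed

text \<open>
  Let \<open>m\<close> and \<open>n\<close> be the projections of \<open>u\<close> and \<open>v\<close> to the path from \<open>s\<close> to \<open>t\<close>. They are comparable on it;
  if they come in the order \<open>s\<close>, \<open>m\<close>, \<open>n\<close>, \<open>t\<close>, then the sum for \<open>{s, t}\<close> and \<open>{u, v}\<close> is at most that for
  \<open>{s, v}\<close> and \<open>{t, u}\<close>, because \<open>d u v\<close> is at most the length of the walk from \<open>u\<close> to \<open>v\<close> via \<open>m\<close> and
  \<open>n\<close>.
\<close>

lemma arc_dist_four_point:
  assumes V: "s \<in> pverts G" "t \<in> pverts G" "u \<in> pverts G" "v \<in> pverts G"
    and w: "\<And>e. e \<in> parcs G \<Longrightarrow> 0 \<le> w e"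
  defines "d \<equiv> \<lambda>x y. arc_dist G w x y + arc_dist G w y x"
  shows "d s t + d u v \<le> max (d s u + d t v) (d s v + d t u)"
proof -
  have sym: "d x y = d y x" for x y by (simp add: d_def)
  have btw: "d x y = d x m + d m y" if "x \<in> pverts G" "y \<in> pverts G" "between x m y" for x m y
    using that between_sym[OF that] by (simp add: d_def arc_dist_between)
  have tri: "d x z \<le> d x y + d y z" if "x \<in> pverts G" "y \<in> pverts G" "z \<in> pverts G" for x y z
    using that arc_dist_triangle[of x y z w] arc_dist_triangle[of z y x w] w
    by (simp add: d_def)
  obtain m where m: "m \<in> pverts G" "between s m t" "between u m s" "between u m t"
    using median_ex[of s t u] V by blast
  obtain n where n: "n \<in> pverts G" "between s n t" "between v n s" "between v n t"
    using median_ex[of s t v] V by blast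
  have uv: "d u v \<le> d u m + d m n + d n v"
    using tri[of u m v] tri[of m n v] m n V by simp
  note eqs = btw[OF _ _ m(2)] btw[OF _ _ m(3)] btw[OF _ _ m(4)]
    btw[OF _ _ n(2)] btw[OF _ _ n(3)] btw[OF _ _ n(4)]
  note syms = sym[of n m] sym[of v t] sym[of t u] sym[of s u] sym[of s v] sym[of m u] sym[of n v]
    sym[of s m] sym[of t m] sym[of s n] sym[of t n]
  from between_linear[OF V(1,2) m(2) n(2)] show ?thesis
  proof
    assume "between s n m"
    from btw[OF _ _ this] eqs uv syms show ?thesis using V m(1) n(1) by simp
  next
    assume "between m n t"
    from btw[OF _ _ this] eqs uv syms show ?thesis using V m(1) n(1) by simp
  qed
qed

end

section \<open>Growing trees\<close>

definition add_leaf :: "'v pair_pre_digraph \<Rightarrow> 'v \<Rightarrow> 'v \<Rightarrow> 'v pair_pre_digraph" where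
  "add_leaf T p z = \<lparr>pverts = insert z (pverts T), parcs = insert (p, z) (insert (z, p) (parcs T))\<rparr>"

lemma add_leaf_simps [simp]:
  "pverts (add_leaf T p z) = insert z (pverts T)"
  "parcs (add_leaf T p z) = insert (p, z) (insert (z, p) (parcs T))"
  by (simp_all add: add_leaf_def)

lemma tree_graph_singleton: "tree_graph \<lparr>pverts = {v}, parcs = {}\<rparr>"
proof -
  let ?T = "\<lparr>pverts = {v}, parcs = {}\<rparr>"
  interpret pair_graph ?T
    by unfold_locales (auto simp: symmetric_def)
  have "strongly_connected (with_proj ?T)"
    by (auto simp: strongly_connected_def intro: reachable_refl)
  then have "connected (with_proj ?T)"
    using pair_sym_digraph_connected_conv[of ?T] pair_sym_digraph_axioms by blast
  moreover have "\<not> cycle p" for p unfolding cycle_def awalk_def by auto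
  ultimately show ?thesis by unfold_locales auto
qed

context tree_graph
begin

lemma pair_graph_add_leaf:
  assumes "p \<in> pverts G" "z \<notin> pverts G"
  shows "pair_graph (add_leaf G p z)"
proof
  fix e assume e: "e \<in> parcs (add_leaf G p z)"
  then show "fst e \<in> pverts (add_leaf G p z)" "snd e \<in> pverts (add_leaf G p z)"
    using assms arc_fst_in_verts[of e] arc_snd_in_verts[of e] by auto
  show "fst e \<noteq> snd e" using e assms pair_no_loops[of e] by auto
next
  show "finite (pverts (add_leaf G p z))" "finite (parcs (add_leaf G p z))"
    using pair_finite_verts pair_finite_arcs by auto
next
  show "symmetric (with_proj (add_leaf G p z))"
    using arcs_symmetric by (auto simp: symmetric_def sym_def)
qed

lemma apath_add_leaf:
  assumes "p \<in> pverts G" "z \<notin> pverts G" "apath x q y"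
  shows "pre_digraph.apath (add_leaf G p z) x q y"
proof -
  interpret H: pair_graph "add_leaf G p z" using assms by (intro pair_graph_add_leaf)
  have "subgraph (with_proj G) (with_proj (add_leaf G p z))"
    unfolding subgraph_def compatible_def
    using wf_digraph_axioms H.wf_digraph_axioms by auto
  then show ?thesis using assms(3) by (intro H.subgraph_apath_imp_apath)
qed

text \<open>
  A cycle through the new vertex, rotated to start there, leaves it to its only neighbour \<open>p\<close> and
  returns from \<open>p\<close>; if it has at least three arcs, it visits \<open>p\<close> twice.
\<close>

lemma tree_graph_add_leaf:
  assumes p: "p \<in> pverts G" and z: "z \<notin> pverts G"
  shows "tree_graph (add_leaf G p z)"
proof -
  interpret H: pair_graph "add_leaf G p z" using assms by (rule pair_graph_add_leaf)
  have to_p: "u \<rightarrow>\<^sup>*\<^bsub>with_proj (add_leaf G p z)\<^esub> p" if "u \<in> pverts (add_leaf G p z)" for u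
  proof (cases "u = z")
    case True
    have "(z, p) \<in> parcs (add_leaf G p z)" by simp
    then show ?thesis using True H.reachable_adjI by blast
  next
    case False
    then have "u \<in> pverts G" using that by simp
    then obtain q where "apath u q p" using apath_ex p by blast
    then show ?thesis using apath_add_leaf[OF p z] H.reachable_apath by blast
  qed
  have "strongly_connected (with_proj (add_leaf G p z))"
    unfolding strongly_connected_def with_proj_simps
  proof (intro conjI ballI)
    fix u v assume "u \<in> pverts (add_leaf G p z)" "v \<in> pverts (add_leaf G p z)"
    then show "u \<rightarrow>\<^sup>*\<^bsub>with_proj (add_leaf G p z)\<^esub> v"
      by (intro H.reachable_trans[OF to_p H.symmetric_reachable'[OF to_p]])
  qed simp
  then have conn: "connected (with_proj (add_leaf G p z))"
    using pair_sym_digraph_connected_conv[of "add_leaf G p z"] H.pair_sym_digraph_axioms by blast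
  have "length c < 3" if c: "H.cycle c" for c
  proof (rule ccontr)
    assume len: "\<not> length c < 3"
    obtain u where u: "H.awalk u c u" "distinct (tl (pawalk_verts u c))" "c \<noteq> []"
      using c unfolding H.cycle_def by blast
    have "pcas u c u" using u(1) unfolding H.awalk_def by blast
    then have "pawalk_verts u c = fst (hd c) # map snd c"
      using H.awalk_verts_conv'[of u c u] u(3) by simp
    then have heads: "distinct (map snd c)" using u(2) by simp
    show False
    proof (cases "z \<in> set (pawalk_verts u c)")
      case True
      then obtain q r where qr: "c = q @ r" "H.awalk u q z" "H.awalk z r u"
        using H.awalk_decomp[OF u(1)] by blast
      have walk: "H.awalk z (r @ q) z" by (rule H.awalk_appendI[OF qr(3,2)])
      have "length (r @ q) \<ge> 3" "distinct (map snd (r @ q))"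
        using len heads qr(1) by auto
      obtain e l where l: "r @ q = e # l"
        using \<open>length (r @ q) \<ge> 3\<close> by (cases "r @ q") auto
      obtain m f where mf: "l = m @ [f]"
        using \<open>length (r @ q) \<ge> 3\<close> l by (cases l rule: rev_cases) auto
      have split: "r @ q = e # m @ [f]" "m \<noteq> []"
        using \<open>length (r @ q) \<ge> 3\<close> l mf by auto
      have "H.awalk z (e # m @ [f]) z" using walk by (simp only: split(1))
      then have e_arc: "e \<in> parcs (add_leaf G p z)" "z = fst e"
        and walk_mf: "H.awalk (snd e) (m @ [f]) z"
        unfolding H.awalk_Cons_iff by blast+
      have e: "e = (z, p)" using e_arc z p in_arcsD1[of z] by (cases e) auto
      obtain l where walk_l: "H.awalk p m l" "H.awalk l [f] z"
        using walk_mf unfolding H.awalk_append_iff e snd_conv by blast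
      then have f: "f \<in> parcs (add_leaf G p z)" "l = fst f" "snd f = z"
        unfolding H.awalk_Cons_iff H.awalk_Nil_iff by blast+
      have "f = (p, z)" using f z p in_arcsD2[of _ z] by (cases f) auto
      with walk_l(1) f(2) have "H.awalk p m p" by (simp only: fst_conv)
      then have "pcas p m p" unfolding H.awalk_def by blast
      then have "last (pawalk_verts p m) = p" by (rule H.awlast_if_cas)
      then have "snd (last m) = p"
        using split(2) H.awalk_verts_conv[of p m] by simp
      then have "p \<in> set (map snd m)" using split(2) by (metis last_in_set list.set_map imageI)
      then show False using \<open>distinct (map snd (r @ q))\<close> unfolding split(1) e by auto
    next
      case False
      have ends: "insert u (fst ` set c \<union> snd ` set c) = set (pawalk_verts u c)"
        using H.set_awalk_verts[OF u(1)] by auto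
      have "set c \<subseteq> parcs G"
      proof
        fix e assume "e \<in> set c"
        moreover from this have "e \<in> parcs (add_leaf G p z)" using u(1) unfolding H.awalk_def by blast
        moreover have "fst e \<noteq> z" "snd e \<noteq> z" using \<open>e \<in> set c\<close> ends False by blast+
        ultimately show "e \<in> parcs G" by auto
      qed
      moreover have "u \<in> pverts G" using u(1) ends False unfolding H.awalk_def by auto
      ultimately have "awalk u c u" using \<open>pcas u c u\<close> unfolding awalk_def by blast
      then have "cycle c" unfolding cycle_def using u by blast
      then show False using tree_acyclic len by blast
    qed
  qed
  then show ?thesis using conn H.pair_graph_axioms
    by (intro tree_graph.intro tree_graph_axioms.intro) auto
qed

lemma tree_path_self: "x \<in> pverts G \<Longrightarrow> tree_path G x x = []"
  by (intro tree_path_eqI) (simp add: apath_Nil_iff)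

lemma arc_dist_self: "x \<in> pverts G \<Longrightarrow> arc_dist G w x x = 0"
  by (simp add: arc_dist_def tree_path_self)

lemma
  assumes p: "p \<in> pverts G" and z: "z \<notin> pverts G" and x: "x \<in> pverts G"
  shows tree_path_add_leaf: "y \<in> pverts G \<Longrightarrow> tree_path (add_leaf G p z) x y = tree_path G x y"
    and tree_path_to_leaf: "tree_path (add_leaf G p z) x z = tree_path G x p @ [(p, z)]"
    and tree_path_from_leaf: "tree_path (add_leaf G p z) z x = (z, p) # tree_path G p x"
proof -
  interpret H: tree_graph "add_leaf G p z" using p z by (rule tree_graph_add_leaf)
  show "tree_path (add_leaf G p z) x y = tree_path G x y" if "y \<in> pverts G"
    by (intro H.tree_path_eqI apath_add_leaf p z apath_tree_path x that)
  have xp: "apath x (tree_path G x p) p" and px: "apath p (tree_path G p x) x"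
    using x p by (auto intro: apath_tree_path)
  then have Hxp: "H.apath x (tree_path G x p) p" and Hpx: "H.apath p (tree_path G p x) x"
    using apath_add_leaf p z by blast+
  have zn: "z \<notin> set (pawalk_verts x (tree_path G x p))" "z \<notin> set (pawalk_verts p (tree_path G p x))"
    using xp px z unfolding apath_def by auto
  have last: "last (pawalk_verts x (tree_path G x p)) = p"
    using xp unfolding apath_def by auto
  have pz: "H.apath p [(p, z)] z"
    using p z by (auto simp: H.apath_simps)
  show "tree_path (add_leaf G p z) x z = tree_path G x p @ [(p, z)]"
    by (intro H.tree_path_eqI) (use Hxp pz zn last in \<open>simp add: H.apath_append_iff\<close>)
  show "tree_path (add_leaf G p z) z x = (z, p) # tree_path G p x"
    by (intro H.tree_path_eqI) (use Hpx zn in \<open>simp add: H.apath_Cons_iff\<close>)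
qed

lemma
  fixes w :: "'v \<times> 'v \<Rightarrow> real" and a b :: real
  assumes p: "p \<in> pverts G" and z: "z \<notin> pverts G" and x: "x \<in> pverts G"
  defines "w' \<equiv> w((p, z) := a, (z, p) := b)"
  shows arc_dist_add_leaf:
      "y \<in> pverts G \<Longrightarrow> arc_dist (add_leaf G p z) w' x y = arc_dist G w x y"
    and arc_dist_to_leaf: "arc_dist (add_leaf G p z) w' x z = arc_dist G w x p + a"
    and arc_dist_from_leaf: "arc_dist (add_leaf G p z) w' z x = b + arc_dist G w p x"
proof -
  have eq: "sum_list (map w' (tree_path G u v)) = sum_list (map w (tree_path G u v))"
    if "u \<in> pverts G" "v \<in> pverts G" for u v
  proof (intro arg_cong[of _ _ sum_list] map_cong[OF refl])
    fix e assume "e \<in> set (tree_path G u v)"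
    then have "e \<in> parcs G" using apath_tree_path[OF that] by (auto simp: apath_def)
    then have "fst e \<noteq> z" "snd e \<noteq> z"
      using z arc_fst_in_verts[of e] arc_snd_in_verts[of e] by metis+
    then have "e \<noteq> (p, z)" "e \<noteq> (z, p)" by auto
    then show "w' e = w e" by (simp add: w'_def)
  qed
  show "arc_dist (add_leaf G p z) w' x y = arc_dist G w x y" if "y \<in> pverts G"
    using tree_path_add_leaf[OF p z x that] eq[OF x that] by (simp add: arc_dist_def)
  have "w' (p, z) = a" "w' (z, p) = b" using p z by (auto simp: w'_def)
  then show "arc_dist (add_leaf G p z) w' x z = arc_dist G w x p + a"
    "arc_dist (add_leaf G p z) w' z x = b + arc_dist G w p x"
    using tree_path_to_leaf[OF p z x] tree_path_from_leaf[OF p z x] eq[OF x p] eq[OF p x]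
    by (simp_all add: arc_dist_def)
qed

end

text \<open>
  The parameter \<open>Q\<close> restricts the pair of weights of the two arcs of an edge. The same construction then
  serves for undirected trees (equal positive weights) and for oriented trees (exactly one weight is positive,
  the other one zero).
\<close>

definition admissible_weights ::
    "(real \<Rightarrow> real \<Rightarrow> bool) \<Rightarrow> 'v pair_pre_digraph \<Rightarrow> ('v \<times> 'v \<Rightarrow> real) \<Rightarrow> bool" where
  "admissible_weights Q T w \<longleftrightarrow> (\<forall>(x, y) \<in> parcs T. Q (w (x, y)) (w (y, x)))"

text \<open>
  The total weights of an undirected path, forwards and backwards, that is made of edges with admissible
  pairs of weights; the path without edges has the weights zero.
\<close>

inductive chain_weight :: "(real \<Rightarrow> real \<Rightarrow> bool) \<Rightarrow> real \<Rightarrow> real \<Rightarrow> bool" for Q where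
  empty: "chain_weight Q 0 0"
| step: "chain_weight Q a b \<Longrightarrow> Q a' b' \<Longrightarrow> chain_weight Q (a + a') (b' + b)"

lemma attach_chain:
  fixes T :: "nat pair_pre_digraph"
  assumes "chain_weight Q a b" and symQ: "\<And>a b. Q a b \<Longrightarrow> Q b a"
    and "tree_graph T" "admissible_weights Q T w" "p \<in> pverts T"
  shows "\<exists>T' w' q. tree_graph T' \<and> admissible_weights Q T' w' \<and> pverts T \<subseteq> pverts T' \<and> q \<in> pverts T' \<and>
    (\<forall>x\<in>pverts T. \<forall>y\<in>pverts T. arc_dist T' w' x y = arc_dist T w x y) \<and>
    (\<forall>x\<in>pverts T. arc_dist T' w' x q = arc_dist T w x p + a \<and> arc_dist T' w' q x = b + arc_dist T w p x)"
  using assms(1)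
proof induction
  case empty
  then show ?case using assms(3-5) by (intro exI[of _ T] exI[of _ w] exI[of _ p]) auto
next
  case (step a b a' b')
  then obtain T' w' q where T': "tree_graph T'" "admissible_weights Q T' w'" "pverts T \<subseteq> pverts T'"
    "q \<in> pverts T'"
    "\<And>x y. x \<in> pverts T \<Longrightarrow> y \<in> pverts T \<Longrightarrow> arc_dist T' w' x y = arc_dist T w x y"
    "\<And>x. x \<in> pverts T \<Longrightarrow> arc_dist T' w' x q = arc_dist T w x p + a"
    "\<And>x. x \<in> pverts T \<Longrightarrow> arc_dist T' w' q x = b + arc_dist T w p x" by blast
  interpret T': tree_graph T' by fact
  obtain z where z: "z \<notin> pverts T'"
    using T'.pair_finite_verts ex_new_if_finite infinite_UNIV_nat by blast
  define v where "v = w'((q, z) := a', (z, q) := b')"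
  have qz: "q \<noteq> z" using T'(4) z by blast
  have vq: "v (q, z) = a'" "v (z, q) = b'" using qz by (simp_all add: v_def)
  have "admissible_weights Q (add_leaf T' q z) v"
    unfolding admissible_weights_def
  proof clarify
    fix x y assume "(x, y) \<in> parcs (add_leaf T' q z)"
    then consider "x = q \<and> y = z" | "x = z \<and> y = q" | "(x, y) \<in> parcs T'" by auto
    then show "Q (v (x, y)) (v (y, x))"
    proof cases
      case 3
      then have "x \<noteq> z" "y \<noteq> z" using z T'.in_arcsD1[OF 3] T'.in_arcsD2[OF 3] by metis+
      then have "v (x, y) = w' (x, y)" "v (y, x) = w' (y, x)" by (simp_all add: v_def)
      then show ?thesis using T'(2) 3 unfolding admissible_weights_def by auto
    qed (use vq step(2) symQ in auto)
  qed
  moreover have "tree_graph (add_leaf T' q z)" using T'(4) z by (rule T'.tree_graph_add_leaf)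
  moreover have "arc_dist (add_leaf T' q z) v x y = arc_dist T w x y"
    if "x \<in> pverts T" "y \<in> pverts T" for x y
    using T'.arc_dist_add_leaf[OF T'(4) z, of x y w' a' b'] T'(3) T'(5)[OF that] that
    unfolding v_def by auto
  moreover have "arc_dist (add_leaf T' q z) v x z = arc_dist T w x p + (a + a')"
    "arc_dist (add_leaf T' q z) v z x = (b' + b) + arc_dist T w p x" if "x \<in> pverts T" for x
    using T'.arc_dist_to_leaf[OF T'(4) z, of x w' a' b'] T'.arc_dist_from_leaf[OF T'(4) z, of x w' a' b']
      T'(3) T'(6,7)[OF that] that
    unfolding v_def by auto
  moreover have "pverts T \<subseteq> pverts (add_leaf T' q z)" using T'(3) by auto
  moreover have "z \<in> pverts (add_leaf T' q z)" by simp
  ultimately show ?case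
    by (intro exI[of _ "add_leaf T' q z"] exI[of _ v] exI[of _ z] conjI ballI)
qed

text \<open>
  The points of \<open>X\<close> may share vertices, so pseudometrics can be realized without passing to a quotient.
\<close>

definition realizable_on ::
    "(real \<Rightarrow> real \<Rightarrow> bool) \<Rightarrow> 'b set \<Rightarrow> ('b \<Rightarrow> 'b \<Rightarrow> real) \<Rightarrow> bool" where
  "realizable_on Q X D \<longleftrightarrow>
     (\<exists>(T :: nat pair_pre_digraph) w v. tree_graph T \<and> admissible_weights Q T w \<and>
        v ` X \<subseteq> pverts T \<and> (\<forall>s\<in>X. \<forall>t\<in>X. D s t = arc_dist T w (v s) (v t)))"

lemma realizable_on_singleton:
  assumes "D x x = 0"
  shows "realizable_on Q {x} D"
proof -
  interpret tree_graph "\<lparr>pverts = {0::nat}, parcs = {}\<rparr>" by (rule tree_graph_singleton)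
  show ?thesis
    unfolding realizable_on_def admissible_weights_def
    using tree_graph_axioms arc_dist_self[of 0] assms
    by (intro exI[of _ "\<lparr>pverts = {0::nat}, parcs = {}\<rparr>"] exI[of _ "\<lambda>_. 0"] exI[of _ "\<lambda>_. 0"]) auto
qed

lemma realizable_on_image:
  assumes "realizable_on Q X D" "h ` Y \<subseteq> X" "\<And>s t. s \<in> Y \<Longrightarrow> t \<in> Y \<Longrightarrow> D' s t = D (h s) (h t)"
  shows "realizable_on Q Y D'"
proof -
  obtain T :: "nat pair_pre_digraph" and w v where T: "tree_graph T" "admissible_weights Q T w"
    "v ` X \<subseteq> pverts T" "\<forall>s\<in>X. \<forall>t\<in>X. D s t = arc_dist T w (v s) (v t)"
    using assms(1) unfolding realizable_on_def by (elim exE conjE)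
  have "(v \<circ> h) ` Y \<subseteq> pverts T" using T(3) assms(2) by auto
  moreover have "\<forall>s\<in>Y. \<forall>t\<in>Y. D' s t = arc_dist T w ((v \<circ> h) s) ((v \<circ> h) t)"
    using T(4) assms(2,3) by (auto simp: image_subset_iff)
  ultimately show ?thesis unfolding realizable_on_def using T(1,2)
    by (intro exI[of _ T] exI[of _ w] exI[of _ "v \<circ> h"] conjI)
qed

text \<open>
  The new point \<open>x\<close> hangs on the vertex of \<open>p\<close> by a path of new edges. If \<open>x\<close> has distance zero from \<open>p\<close> in
  both directions, no edge is added and \<open>x\<close> gets the vertex of \<open>p\<close>.
\<close>

lemma realizable_on_insert:
  assumes real: "realizable_on Q X D" and symQ: "\<And>a b. Q a b \<Longrightarrow> Q b a"
    and p: "p \<in> X" and x: "x \<notin> X" "D x x = 0"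
    and add: "\<And>y. y \<in> X \<Longrightarrow> D y x = D y p + D p x" "\<And>y. y \<in> X \<Longrightarrow> D x y = D x p + D p y"
    and chain: "chain_weight Q (D p x) (D x p)"
  shows "realizable_on Q (insert x X) D"
proof -
  obtain T :: "nat pair_pre_digraph" and w v where T: "tree_graph T" "admissible_weights Q T w"
    and v: "v ` X \<subseteq> pverts T" and D': "\<forall>s\<in>X. \<forall>t\<in>X. D s t = arc_dist T w (v s) (v t)"
    using real unfolding realizable_on_def by (elim exE conjE)
  have D: "D s t = arc_dist T w (v s) (v t)" if "s \<in> X" "t \<in> X" for s t
    using D' that by blast
  have vX: "v y \<in> pverts T" if "y \<in> X" for y using v that by blast
  obtain T' w' q where T': "tree_graph T'" "admissible_weights Q T' w'" "pverts T \<subseteq> pverts T'"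
    "q \<in> pverts T'"
    "\<And>x y. x \<in> pverts T \<Longrightarrow> y \<in> pverts T \<Longrightarrow> arc_dist T' w' x y = arc_dist T w x y"
    "\<And>y. y \<in> pverts T \<Longrightarrow> arc_dist T' w' y q = arc_dist T w y (v p) + D p x"
    "\<And>y. y \<in> pverts T \<Longrightarrow> arc_dist T' w' q y = D x p + arc_dist T w (v p) y"
    using attach_chain[OF chain symQ T vX[OF p]] by blast
  interpret T': tree_graph T' by fact
  let ?v = "v(x := q)"
  have "?v ` insert x X \<subseteq> pverts T'" using v T'(3,4) by auto
  moreover have "D s t = arc_dist T' w' (?v s) (?v t)" if "s \<in> insert x X" "t \<in> insert x X" for s t
  proof -
    have "D y x = arc_dist T' w' (v y) q" "D x y = arc_dist T' w' q (v y)" if "y \<in> X" for y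
      using add[OF that] T'(6,7)[OF vX[OF that]] D[OF that p] D[OF p that] by simp_all
    moreover have "D x x = arc_dist T' w' q q" using x(2) T'.arc_dist_self[OF T'(4)] by simp
    ultimately show ?thesis using that x(1) D T'(5) vX by auto
  qed
  ultimately show ?thesis unfolding realizable_on_def using T'(1,2)
    by (intro exI[of _ T'] exI[of _ w'] exI[of _ ?v] conjI ballI)
qed

section \<open>Matchings and the tropical rank\<close>

lemma directed_metric_onD:
  assumes "directed_metric_on S \<mu>"
  shows "\<And>x y. x \<in> S \<Longrightarrow> y \<in> S \<Longrightarrow> 0 \<le> \<mu> x y"
    and "\<And>x. x \<in> S \<Longrightarrow> \<mu> x x = 0"
    and "\<And>x y z. x \<in> S \<Longrightarrow> y \<in> S \<Longrightarrow> z \<in> S \<Longrightarrow> \<mu> x z \<le> \<mu> x y + \<mu> y z"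
  using assms unfolding directed_metric_on_def by blast+

text \<open>
  Bijections are easier to modify at single points and to sum over than sets of pairs.
\<close>

lemma perfect_matching_iff_graph:
  "perfect_matching A B M \<longleftrightarrow> (\<exists>f. bij_betw f A B \<and> M = (\<lambda>a. (a, f a)) ` A)"
proof
  assume M: "perfect_matching A B M"
  define f where "f a = (THE b. (a, b) \<in> M)" for a
  have f: "(a, b) \<in> M \<longleftrightarrow> b = f a" if "a \<in> A" for a b
    using M that unfolding perfect_matching_def f_def by (metis theI')
  have sub: "M \<subseteq> A \<times> B" using M by (simp add: perfect_matching_def)
  have "M = (\<lambda>a. (a, f a)) ` A" using f sub by auto
  moreover have "bij_betw f A B"
    unfolding bij_betw_def inj_on_def
  proof (intro conjI ballI impI set_eqI iffI)
    fix x y assume "x \<in> A" "y \<in> A" "f x = f y"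
    then show "x = y" using M f sub unfolding perfect_matching_def
      by (metis SigmaD2 subset_iff)
  next
    fix b assume "b \<in> f ` A"
    then show "b \<in> B" using f sub by blast
  next
    fix b assume "b \<in> B"
    then obtain a where "(a, b) \<in> M" using M unfolding perfect_matching_def by blast
    then show "b \<in> f ` A" using f sub by blast
  qed
  ultimately show "\<exists>f. bij_betw f A B \<and> M = (\<lambda>a. (a, f a)) ` A" by blast
next
  assume "\<exists>f. bij_betw f A B \<and> M = (\<lambda>a. (a, f a)) ` A"
  then obtain f where "bij_betw f A B" "M = (\<lambda>a. (a, f a)) ` A" by blast
  then show "perfect_matching A B M"
    unfolding perfect_matching_def bij_betw_def inj_on_def by auto
qed

lemma matching_weight_graph: "matching_weight \<mu> ((\<lambda>a. (a, f a)) ` A) = (\<Sum>a\<in>A. \<mu> a (f a))"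
  unfolding matching_weight_def
  by (subst sum.reindex) (auto simp: inj_on_def)

lemma unique_arg_max_iff:
  fixes f :: "'b \<Rightarrow> real"
  shows "(\<exists>!x. is_arg_max f P x) \<longleftrightarrow> (\<exists>x. P x \<and> (\<forall>y. P y \<and> y \<noteq> x \<longrightarrow> f y < f x))"
proof
  assume "\<exists>!x. is_arg_max f P x"
  then obtain x where x: "is_arg_max f P x" and uniq: "\<And>y. is_arg_max f P y \<Longrightarrow> y = x" by blast
  have "f y < f x" if "P y" "y \<noteq> x" for y
  proof (rule ccontr)
    assume "\<not> f y < f x"
    then have "is_arg_max f P y"
      using x that unfolding is_arg_max_def by (meson linorder_not_less order_le_less_trans)
    with uniq that show False by blast
  qed
  with x show "\<exists>x. P x \<and> (\<forall>y. P y \<and> y \<noteq> x \<longrightarrow> f y < f x)"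
    unfolding is_arg_max_def by blast
next
  assume "\<exists>x. P x \<and> (\<forall>y. P y \<and> y \<noteq> x \<longrightarrow> f y < f x)"
  then obtain x where "P x" "\<And>y. P y \<Longrightarrow> y \<noteq> x \<Longrightarrow> f y < f x" by blast
  then show "\<exists>!x. is_arg_max f P x"
    unfolding is_arg_max_def by (intro ex1I[of _ x]) (force, metis)
qed

text \<open>
  Among the six permutations of the columns, the identity alone has the largest sum.
\<close>

definition uniquely_maximal3 ::
    "('a \<Rightarrow> 'a \<Rightarrow> real) \<Rightarrow> 'a \<times> 'a \<times> 'a \<Rightarrow> 'a \<times> 'a \<times> 'a \<Rightarrow> bool" where
  "uniquely_maximal3 \<mu> = (\<lambda>(a1, a2, a3) (b1, b2, b3).
     let m = \<mu> a1 b1 + \<mu> a2 b2 + \<mu> a3 b3 in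
       \<mu> a1 b1 + \<mu> a2 b3 + \<mu> a3 b2 < m \<and> \<mu> a1 b2 + \<mu> a2 b1 + \<mu> a3 b3 < m \<and>
       \<mu> a1 b3 + \<mu> a2 b2 + \<mu> a3 b1 < m \<and> \<mu> a1 b2 + \<mu> a2 b3 + \<mu> a3 b1 < m \<and>
       \<mu> a1 b3 + \<mu> a2 b1 + \<mu> a3 b2 < m)"

text \<open>
  All six sums change by the same amount, since each row and each column occurs in each of them once.
\<close>

lemma uniquely_maximal3_potential:
  assumes "\<And>a b. a \<in> {a1, a2, a3} \<Longrightarrow> b \<in> {b1, b2, b3} \<Longrightarrow> \<mu> a b = d a b / 2 + \<pi> b - \<pi> a"
  shows "uniquely_maximal3 \<mu> (a1, a2, a3) (b1, b2, b3) \<longleftrightarrow> uniquely_maximal3 d (a1, a2, a3) (b1, b2, b3)"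
proof -
  have "\<mu> a1 b1 = d a1 b1 / 2 + \<pi> b1 - \<pi> a1" "\<mu> a1 b2 = d a1 b2 / 2 + \<pi> b2 - \<pi> a1"
    "\<mu> a1 b3 = d a1 b3 / 2 + \<pi> b3 - \<pi> a1" "\<mu> a2 b1 = d a2 b1 / 2 + \<pi> b1 - \<pi> a2"
    "\<mu> a2 b2 = d a2 b2 / 2 + \<pi> b2 - \<pi> a2" "\<mu> a2 b3 = d a2 b3 / 2 + \<pi> b3 - \<pi> a2"
    "\<mu> a3 b1 = d a3 b1 / 2 + \<pi> b1 - \<pi> a3" "\<mu> a3 b2 = d a3 b2 / 2 + \<pi> b2 - \<pi> a3"
    "\<mu> a3 b3 = d a3 b3 / 2 + \<pi> b3 - \<pi> a3"
    by (intro assms; simp)+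
  then show ?thesis
    unfolding uniquely_maximal3_def Let_def prod.case by (intro iffI; elim conjE; intro conjI; linarith)
qed

text \<open>
  Permuting the partners of three points within the optimal matching yields another perfect
  matching, which must be lighter. This reduces matchings of every larger size to size three.
\<close>

lemma uniquely_maximal3_if_unique_arg_max:
  assumes fin: "finite A" and uniq: "\<exists>!M. is_arg_max (matching_weight \<mu>) (perfect_matching A B) M"
    and card: "card A \<ge> 3"
  obtains a1 a2 a3 b1 b2 b3 where "{a1, a2, a3} \<subseteq> A" "{b1, b2, b3} \<subseteq> B"
    "uniquely_maximal3 \<mu> (a1, a2, a3) (b1, b2, b3)"
proof -
  obtain M where pm: "perfect_matching A B M"
    and M: "\<And>N. perfect_matching A B N \<Longrightarrow> N \<noteq> M \<Longrightarrow> matching_weight \<mu> N < matching_weight \<mu> M"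
    using uniq unfolding unique_arg_max_iff by blast
  obtain f where f: "bij_betw f A B" and Mf: "M = (\<lambda>a. (a, f a)) ` A"
    using pm unfolding perfect_matching_iff_graph by blast
  obtain X where X: "X \<subseteq> A" "card X = 3"
    using card obtain_subset_with_card_n by metis
  then obtain a1 a2 a3 where a: "X = {a1, a2, a3}" "a1 \<noteq> a2" "a2 \<noteq> a3" "a1 \<noteq> a3"
    by (auto simp: card_3_iff)
  have aA: "a1 \<in> A" "a2 \<in> A" "a3 \<in> A" using X a by auto
  have inj: "f x = f y \<longleftrightarrow> x = y" if "x \<in> A" "y \<in> A" for x y
    using f that by (auto simp: bij_betw_def inj_on_def)
  have swap: "\<mu> a1 (f x) + \<mu> a2 (f y) + \<mu> a3 (f z) < \<mu> a1 (f a1) + \<mu> a2 (f a2) + \<mu> a3 (f a3)"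
    if xyz: "(x, y, z) \<in> {(a1,a3,a2), (a2,a1,a3), (a3,a2,a1), (a2,a3,a1), (a3,a1,a2)}" for x y z
  proof -
    define g where "g = f(a1 := f x, a2 := f y, a3 := f z)"
    have xyzA: "x \<in> A" "y \<in> A" "z \<in> A" using xyz aA by auto
    have g: "g a1 = f x" "g a2 = f y" "g a3 = f z" "\<And>b. b \<notin> X \<Longrightarrow> g b = f b"
      using a by (auto simp: g_def)
    define \<sigma> where "\<sigma> = id(a1 := x, a2 := y, a3 := z)"
    have "inj_on \<sigma> A" unfolding inj_on_def \<sigma>_def fun_upd_apply id_apply
      using xyz a(2-4) by (elim insertE emptyE Pair_inject; hypsubst; metis)
    moreover have "\<sigma> ` A \<subseteq> A" using xyzA by (auto simp: \<sigma>_def)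
    moreover have "g = f \<circ> \<sigma>" by (auto simp: g_def \<sigma>_def)
    ultimately have "inj_on g A"
      using f by (auto simp: bij_betw_def intro!: comp_inj_on intro: inj_on_subset)
    moreover have "g ` A \<subseteq> B"
      using bij_betwE[OF f] xyzA by (auto simp: g_def)
    ultimately have "bij_betw g A B"
      using card_subset_eq[of B "g ` A"] card_image[of g A] fin bij_betw_same_card[OF f] bij_betw_finite[OF f]
      by (simp add: bij_betw_def)
    moreover have "(\<lambda>a. (a, g a)) ` A \<noteq> M"
    proof
      assume "(\<lambda>a. (a, g a)) ` A = M"
      then have "g a = f a" if "a \<in> A" for a unfolding Mf using that by force
      then have "f x = f a1" "f y = f a2" using g aA by metis+
      then have "x = a1" "y = a2" using inj xyzA aA by blast+
      then show False using xyz a by auto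
    qed
    ultimately have less: "(\<Sum>a\<in>A. \<mu> a (g a)) < (\<Sum>a\<in>A. \<mu> a (f a))"
      using M[of "(\<lambda>a. (a, g a)) ` A"] unfolding perfect_matching_iff_graph Mf matching_weight_graph
      by blast
    have "(\<Sum>a\<in>A. h a) = h a1 + h a2 + h a3 + (\<Sum>a\<in>A - X. h a)" for h :: "_ \<Rightarrow> real"
      using sum.subset_diff[OF X(1) fin, of h] a by simp
    moreover have "(\<Sum>a\<in>A - X. \<mu> a (g a)) = (\<Sum>a\<in>A - X. \<mu> a (f a))"
      using g(4) by (intro sum.cong) auto
    ultimately show ?thesis using less g by simp
  qed
  have "uniquely_maximal3 \<mu> (a1, a2, a3) (f a1, f a2, f a3)"
    unfolding uniquely_maximal3_def Let_def prod.case using a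
    by (intro conjI swap) simp_all
  then show ?thesis using that[of a1 a2 a3 "f a1" "f a2" "f a3"] aA bij_betwE[OF f] by auto
qed

lemma unique_arg_max_if_uniquely_maximal3:
  assumes a: "distinct [a1, a2, a3]" and b: "distinct [b1, b2, b3]"
    and max3: "uniquely_maximal3 \<mu> (a1, a2, a3) (b1, b2, b3)"
  shows "\<exists>!M. is_arg_max (matching_weight \<mu>) (perfect_matching {a1, a2, a3} {b1, b2, b3}) M"
proof -
  let ?A = "{a1, a2, a3}" and ?B = "{b1, b2, b3}" and ?M = "{(a1, b1), (a2, b2), (a3, b3)}"
  have wM: "matching_weight \<mu> ?M = \<mu> a1 b1 + \<mu> a2 b2 + \<mu> a3 b3"
    using a by (simp add: matching_weight_def)
  have "perfect_matching ?A ?B ?M"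
    unfolding perfect_matching_def using a b by auto
  moreover have "matching_weight \<mu> N < matching_weight \<mu> ?M"
    if N: "perfect_matching ?A ?B N" "N \<noteq> ?M" for N
  proof -
    obtain f where f: "bij_betw f ?A ?B" and Nf: "N = (\<lambda>a. (a, f a)) ` ?A"
      using N unfolding perfect_matching_iff_graph by blast
    have w: "matching_weight \<mu> N = \<mu> a1 (f a1) + \<mu> a2 (f a2) + \<mu> a3 (f a3)"
      unfolding Nf matching_weight_graph using a by simp
    have "f a1 \<in> ?B" "f a2 \<in> ?B" "f a3 \<in> ?B" using bij_betwE[OF f] by auto
    moreover have "f a1 \<noteq> f a2" "f a1 \<noteq> f a3" "f a2 \<noteq> f a3"
      using f a by (auto simp: bij_betw_def inj_on_def)
    moreover have "\<not> (f a1 = b1 \<and> f a2 = b2 \<and> f a3 = b3)" using N(2) Nf by auto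
    ultimately show ?thesis
      using max3 unfolding w wM uniquely_maximal3_def Let_def prod.case by auto
  qed
  ultimately show ?thesis unfolding unique_arg_max_iff by blast
qed

lemma tropical_rank_le_2_iff:
  assumes "finite S"
  shows "tropical_rank_uminus S \<mu> \<le> 2 \<longleftrightarrow>
    (\<forall>A B. A \<subseteq> S \<longrightarrow> B \<subseteq> S \<longrightarrow> card A = card B \<longrightarrow> card A \<ge> 3 \<longrightarrow>
        \<not> (\<exists>!M. is_arg_max (matching_weight \<mu>) (perfect_matching A B) M))"
proof -
  let ?R = "{n. \<exists>A B. A \<subseteq> S \<and> B \<subseteq> S \<and> card A = n \<and> card B = n \<and>
               (\<exists>!M. is_arg_max (matching_weight \<mu>) (perfect_matching A B) M)}"
  have fin: "finite ?R"
    by (rule finite_subset[of _ "{..card S}"]) (auto intro: card_mono[OF assms])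
  have "\<exists>!M. is_arg_max (matching_weight \<mu>) (perfect_matching {} {}) M"
    unfolding unique_arg_max_iff by (auto simp: perfect_matching_def)
  then have "{} \<subseteq> S \<and> {} \<subseteq> S \<and> card ({} :: 'a set) = 0 \<and> card ({} :: 'a set) = 0 \<and>
      (\<exists>!M. is_arg_max (matching_weight \<mu>) (perfect_matching {} {}) M)"
    by (intro conjI empty_subsetI card.empty)
  then have "0 \<in> ?R" by (intro CollectI exI)
  then have "?R \<noteq> {}" by (metis empty_iff)
  with fin have "tropical_rank_uminus S \<mu> \<le> 2 \<longleftrightarrow> (\<forall>n\<in>?R. n \<le> 2)"
    unfolding tropical_rank_uminus_def by (rule Max_le_iff)
  also have "\<dots> \<longleftrightarrow> (\<forall>A B. A \<subseteq> S \<longrightarrow> B \<subseteq> S \<longrightarrow> card A = card B \<longrightarrow> card A \<ge> 3 \<longrightarrow>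
        \<not> (\<exists>!M. is_arg_max (matching_weight \<mu>) (perfect_matching A B) M))" (is "?L \<longleftrightarrow> ?Q")
  proof
    assume L: ?L
    show ?Q
    proof (intro allI impI notI)
      fix A B assume "A \<subseteq> S" "B \<subseteq> S" and card: "card A = card B" "card A \<ge> 3"
        and "\<exists>!M. is_arg_max (matching_weight \<mu>) (perfect_matching A B) M"
      then have "card A \<in> ?R" by (intro CollectI exI conjI) (assumption | rule refl card(1)[symmetric])+
      with L have "card A \<le> 2" by (rule bspec)
      with card show False by simp
    qed
  next
    assume Q: ?Q
    show ?L
    proof (intro ballI, elim CollectE exE conjE)
      fix n A B assume "A \<subseteq> S" "B \<subseteq> S" and card: "card A = n" "card B = n"
        and "\<exists>!M. is_arg_max (matching_weight \<mu>) (perfect_matching A B) M"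
      with Q[rule_format, of A B] have "\<not> card A \<ge> 3" by metis
      with card show "n \<le> 2" by simp
    qed
  qed
  finally show ?thesis .
qed

definition cyclic_symmetric_on :: "'a set \<Rightarrow> ('a \<Rightarrow> 'a \<Rightarrow> real) \<Rightarrow> bool" where
  "cyclic_symmetric_on S \<mu> \<longleftrightarrow>
     (\<forall>x\<in>S. \<forall>y\<in>S. \<forall>z\<in>S. \<mu> x y + \<mu> y z + \<mu> z x = \<mu> z y + \<mu> y x + \<mu> x z)"

abbreviation (input) symmetrization :: "('a \<Rightarrow> 'a \<Rightarrow> real) \<Rightarrow> 'a \<Rightarrow> 'a \<Rightarrow> real" where
  "symmetrization \<mu> x y \<equiv> \<mu> x y + transp_fun \<mu> x y"

text \<open>
  With an arbitrary base point \<open>r\<close>, the identity for the triple \<open>r\<close>, \<open>x\<close>, \<open>y\<close> expresses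
  \<open>\<mu> x y - \<mu> y x\<close> by the corresponding differences for \<open>r\<close>, \<open>x\<close> and for \<open>r\<close>, \<open>y\<close>.
\<close>

lemma cyclic_symmetric_potential:
  assumes "cyclic_symmetric_on S \<mu>"
  obtains \<pi> where "\<And>x y. x \<in> S \<Longrightarrow> y \<in> S \<Longrightarrow> \<mu> x y = symmetrization \<mu> x y / 2 + \<pi> y - \<pi> x"
proof (cases "S = {}")
  case True
  then show ?thesis using that by blast
next
  case False
  then obtain r where r: "r \<in> S" by blast
  show ?thesis
  proof (rule that)
    fix x y assume xy: "x \<in> S" "y \<in> S"
    then have "\<mu> r x + \<mu> x y + \<mu> y r = \<mu> y x + \<mu> x r + \<mu> r y"
      using assms r unfolding cyclic_symmetric_on_def by blast
    then show "\<mu> x y = symmetrization \<mu> x y / 2 + (\<mu> r y - \<mu> y r) / 2 - (\<mu> r x - \<mu> x r) / 2"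
      by (simp add: transp_fun_def field_simps)
  qed
qed

text \<open>
  The function \<open>g\<close> below is twice the Gromov product at \<open>a1\<close>. Up to terms that occur in all six sums, the
  distances are \<open>- g\<close>, so the identity would be the only permutation with the smallest sum of \<open>g\<close>. As \<open>g\<close>
  vanishes in the row \<open>a1\<close>, only the rows \<open>a2\<close> and \<open>a3\<close> count. Say \<open>g a2 b2 \<le> g a3 b3\<close>; the other case is
  symmetric. Exchanging the partner of \<open>a1\<close> with that of \<open>a2\<close> or of \<open>a3\<close> shows that \<open>g a2 b2 < g a2 b1\<close> and
  \<open>g a3 b3 < g a3 b1\<close>. In a triple of an ultrametric similarity the smallest value occurs twice, whence in turn
  \<open>g b1 b2 = g a2 b2\<close>, \<open>g b1 b3 = g a3 b3\<close>, and \<open>g a3 b2 = g a2 b2\<close>. The comparison with the permutation that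
  exchanges \<open>b2\<close> and \<open>b3\<close> now gives \<open>g a3 b3 < g a2 b3\<close>, so \<open>g a2 b1 = g a3 b3\<close> and the remaining permutation,
  with \<open>b1\<close> for \<open>a2\<close> and \<open>b2\<close> for \<open>a3\<close>, attains the same sum as the identity.
\<close>

lemma four_point_imp_not_uniquely_maximal3:
  assumes "four_point_on S d" "\<And>x y. x \<in> S \<Longrightarrow> y \<in> S \<Longrightarrow> d x y = d y x" "\<And>x. x \<in> S \<Longrightarrow> d x x = 0"
    and A: "{a1, a2, a3} \<subseteq> S" and B: "{b1, b2, b3} \<subseteq> S"
  shows "\<not> uniquely_maximal3 d (a1, a2, a3) (b1, b2, b3)"
proof
  define g where "g x y = d a1 x + d a1 y - d x y" for x y
  have S: "a1 \<in> S" "a2 \<in> S" "a3 \<in> S" "b1 \<in> S" "b2 \<in> S" "b3 \<in> S" using A B by auto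
  have um: "min (g x y) (g y z) \<le> g x z" if "x \<in> S" "y \<in> S" "z \<in> S" for x y z
  proof -
    have "d x z + d a1 y \<le> max (d x a1 + d z y) (d x y + d z a1)"
      using assms(1) that S unfolding four_point_on_def by blast
    then show ?thesis
      using assms(2)[of x a1] assms(2)[of z a1] assms(2)[of z y] that S by (simp add: g_def max_def min_def split: if_splits)
  qed
  have sym: "g x y = g y x" if "x \<in> S" "y \<in> S" for x y
    using assms(2)[OF that] by (simp add: g_def)
  have d: "d x y = d a1 x + d a1 y - g x y" for x y by (simp add: g_def)
  have g0: "g a1 y = 0" for y using assms(3) S by (simp add: g_def)
  assume max3: "uniquely_maximal3 d (a1, a2, a3) (b1, b2, b3)"
  have less: "g a2 b2 + g a3 b3 < g a2 b3 + g a3 b2" "g a2 b2 + g a3 b3 < g a2 b1 + g a3 b3"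
     "g a2 b2 + g a3 b3 < g a2 b2 + g a3 b1" "g a2 b2 + g a3 b3 < g a2 b3 + g a3 b1"
     "g a2 b2 + g a3 b3 < g a2 b1 + g a3 b2"
    using max3 unfolding uniquely_maximal3_def Let_def prod.case
      d[of a2] d[of a3] by linarith+
  note um3 = um[of a2 b1 b2] um[of a2 b2 b1] um[of a2 b3 b1] um[of a2 b1 b3]
     um[of a2 b2 b3] um[of a2 b3 b2] um[of a3 b1 b2] um[of a3 b2 b1] um[of a3 b3 b1] um[of a3 b1 b3]
     um[of a3 b2 b3] um[of a3 b3 b2] um[of b1 a2 b2] um[of b1 a2 b3] um[of b2 a2 b3]
     um[of b1 a3 b2] um[of b1 a3 b3] um[of b2 a3 b3] um[of b1 b2 b3] um[of b1 b3 b2] um[of b2 b1 b3]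
  note syms = sym[of b2 b1] sym[of b3 b1] sym[of b3 b2] sym[of b1 a2] sym[of b1 a3]
    sym[of b2 a2] sym[of b2 a3] sym[of b3 a2] sym[of b3 a3]
  show False using um3[unfolded min_def] less syms S by (smt (verit))
qed

lemma tropical_rank_le_2_if_four_point:
  assumes fin: "finite S" and dm: "directed_metric_on S \<mu>"
    and fp: "four_point_on S (symmetrization \<mu>)" and cyc: "cyclic_symmetric_on S \<mu>"
  shows "tropical_rank_uminus S \<mu> \<le> 2"
  unfolding tropical_rank_le_2_iff[OF fin]
proof (intro allI impI notI)
  fix A B assume AB: "A \<subseteq> S" "B \<subseteq> S" "card A = card B" "card A \<ge> 3"
    "\<exists>!M. is_arg_max (matching_weight \<mu>) (perfect_matching A B) M"
  obtain a1 a2 a3 b1 b2 b3 where ab: "{a1, a2, a3} \<subseteq> A" "{b1, b2, b3} \<subseteq> B"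
      "uniquely_maximal3 \<mu> (a1, a2, a3) (b1, b2, b3)"
    by (rule uniquely_maximal3_if_unique_arg_max[OF finite_subset[OF AB(1) fin] AB(5,4)])
  obtain \<pi> where \<pi>: "\<And>x y. x \<in> S \<Longrightarrow> y \<in> S \<Longrightarrow> \<mu> x y = symmetrization \<mu> x y / 2 + \<pi> y - \<pi> x"
    using cyclic_symmetric_potential[OF cyc] by blast
  have \<mu>: "\<mu> a b = symmetrization \<mu> a b / 2 + \<pi> b - \<pi> a"
    if "a \<in> {a1, a2, a3}" "b \<in> {b1, b2, b3}" for a b
    using subsetD[OF ab(1) that(1)] subsetD[OF ab(2) that(2)] AB(1,2) by (intro \<pi>) auto
  have "uniquely_maximal3 (symmetrization \<mu>) (a1, a2, a3) (b1, b2, b3)"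
    by (rule uniquely_maximal3_potential[THEN iffD1, OF \<mu> ab(3)])
  moreover have "\<not> uniquely_maximal3 (symmetrization \<mu>) (a1, a2, a3) (b1, b2, b3)"
    using ab AB directed_metric_onD(2)[OF dm]
    by (intro four_point_imp_not_uniquely_maximal3[OF fp]) (auto simp: transp_fun_def)
  ultimately show False by blast
qed

text \<open>
  For a triple with different cyclic sums, take \<open>{x, y, z}\<close> on both sides: by the triangle
  inequality, neither the three exchanges nor the identity exceed either cyclic sum, so the larger one is attained
  only once. If the four point condition fails with a strict excess of \<open>{s, t}\<close> and \<open>{u, v}\<close>, take the rows \<open>s\<close>, \<open>t\<close>, \<open>u\<close>
  and the columns \<open>t\<close>, \<open>s\<close>, \<open>v\<close>: matching \<open>s\<close> with \<open>t\<close> in both ways and \<open>u\<close> with \<open>v\<close> is then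
  the only optimal choice.
\<close>

lemma four_point_cyclic_if_tropical_rank_le_2:
  assumes fin: "finite S" and dm: "directed_metric_on S \<mu>" and rank: "tropical_rank_uminus S \<mu> \<le> 2"
  shows "four_point_on S (symmetrization \<mu>) \<and> cyclic_symmetric_on S \<mu>"
proof -
  note nn = directed_metric_onD(1)[OF dm] and z = directed_metric_onD(2)[OF dm]
    and tri = directed_metric_onD(3)[OF dm]
  have max3: False if "distinct [a1, a2, a3]" "distinct [b1, b2, b3]" "{a1, a2, a3} \<subseteq> S" "{b1, b2, b3} \<subseteq> S"
     "uniquely_maximal3 \<mu> (a1, a2, a3) (b1, b2, b3)" for a1 a2 a3 b1 b2 b3
  proof -
    have "card {a1, a2, a3} = 3" "card {b1, b2, b3} = 3" using that(1,2) by auto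
    then have "card {a1, a2, a3} = card {b1, b2, b3}" "3 \<le> card {a1, a2, a3}" by simp_all
    then have "\<not> (\<exists>!M. is_arg_max (matching_weight \<mu>) (perfect_matching {a1, a2, a3} {b1, b2, b3}) M)"
      by (rule rank[unfolded tropical_rank_le_2_iff[OF fin], rule_format, OF that(3,4)])
    then show False using unique_arg_max_if_uniquely_maximal3[OF that(1,2,5)] by (rule notE)
  qed
  have le: "\<mu> x y + \<mu> y z + \<mu> z x \<le> \<mu> z y + \<mu> y x + \<mu> x z" if S: "x \<in> S" "y \<in> S" "z \<in> S" for x y z
  proof (rule ccontr)
    assume less: "\<not> ?thesis"
    then have ne: "x \<noteq> y" "y \<noteq> z" "x \<noteq> z" using z[OF S(1)] z[OF S(2)] z[OF S(3)] by auto
    have "uniquely_maximal3 \<mu> (x, y, z) (y, z, x)"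
      unfolding uniquely_maximal3_def Let_def prod.case
      using less z[OF S(1)] z[OF S(2)] z[OF S(3)]
        tri[OF S(1,2,3)] tri[OF S(2,3,1)] tri[OF S(3,1,2)] tri[OF S(3,2,1)] tri[OF S(2,1,3)] tri[OF S(1,3,2)]
        nn[OF S(1,2)] nn[OF S(2,1)] nn[OF S(1,3)] nn[OF S(3,1)] nn[OF S(2,3)] nn[OF S(3,2)]
      by (intro conjI; linarith)
    moreover have "distinct [x, y, z]" "distinct [y, z, x]" "{x, y, z} \<subseteq> S" "{y, z, x} \<subseteq> S"
      using ne S by auto
    ultimately show False by (intro max3[of x y z y z x])
  qed
  have cyc: "cyclic_symmetric_on S \<mu>"
    unfolding cyclic_symmetric_on_def
  proof (intro ballI)
    fix x y z assume "x \<in> S" "y \<in> S" "z \<in> S"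
    then show "\<mu> x y + \<mu> y z + \<mu> z x = \<mu> z y + \<mu> y x + \<mu> x z"
      using le[of x y z] le[of x z y] by linarith
  qed
  obtain \<pi> where \<pi>: "\<And>x y. x \<in> S \<Longrightarrow> y \<in> S \<Longrightarrow> \<mu> x y = symmetrization \<mu> x y / 2 + \<pi> y - \<pi> x"
    using cyclic_symmetric_potential[OF cyc] by blast
  define d where "d = symmetrization \<mu>"
  have dsym: "d x y = d y x" for x y by (simp add: d_def transp_fun_def)
  have d0: "d x x = 0" if "x \<in> S" for x using z[OF that] by (simp add: d_def transp_fun_def)
  have dnn: "d x y \<ge> 0" if "x \<in> S" "y \<in> S" for x y
    using nn[OF that] nn[OF that(2,1)] by (simp add: d_def transp_fun_def)
  have dtri: "d x z \<le> d x y + d y z" if "x \<in> S" "y \<in> S" "z \<in> S" for x y z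
    using tri[OF that] tri[OF that(3,2,1)] by (simp add: d_def transp_fun_def)
  have "d s t + d u v \<le> max (d s u + d t v) (d s v + d t u)"
    if S: "s \<in> S" "t \<in> S" "u \<in> S" "v \<in> S" for s t u v
  proof (rule ccontr)
    assume "\<not> ?thesis"
    then have less: "d s u + d t v < d s t + d u v" "d s v + d t u < d s t + d u v" by auto
    note facts = less d0[OF S(1)] d0[OF S(2)] dnn[OF S(1,2)]
      dtri[OF S(3,1,4)] dtri[OF S(2,1,4)] dtri[OF S(1,2,4)] dtri[OF S(2,1,3)] dtri[OF S(1,2,3)]
      dtri[OF S(3,2,4)] dsym[of t s] dsym[of u s] dsym[of u t]
    have "s \<noteq> t" using less d0[OF S(1)] dtri[OF S(3,1,4)] dsym[of u s] by force
    moreover have "s \<noteq> u" using less(2) dsym[of t s] by force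
    moreover have "t \<noteq> u" using less(1) by force
    moreover have "s \<noteq> v" using less(1) dsym[of t s] dsym[of u s] by force
    moreover have "t \<noteq> v" using less(2) dsym[of u t] by force
    ultimately have ne: "s \<noteq> t" "s \<noteq> u" "t \<noteq> u" "s \<noteq> v" "t \<noteq> v" by blast+
    have "uniquely_maximal3 d (s, t, u) (t, s, v)"
      unfolding uniquely_maximal3_def Let_def prod.case using facts by (intro conjI; linarith)
    moreover have "\<mu> a b = d a b / 2 + \<pi> b - \<pi> a" if "a \<in> {s, t, u}" "b \<in> {t, s, v}" for a b
      unfolding d_def using that S by (intro \<pi>) auto
    ultimately have "uniquely_maximal3 \<mu> (s, t, u) (t, s, v)"
      using uniquely_maximal3_potential[of s t u t s v \<mu> d \<pi>] by simp
    moreover have "distinct [s, t, u]" "distinct [t, s, v]" "{s, t, u} \<subseteq> S" "{t, s, v} \<subseteq> S"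
      using ne S by auto
    ultimately show False by (intro max3[of s t u t s v])
  qed
  with cyc show ?thesis by (auto simp: four_point_on_def d_def)
qed

section \<open>The tree of an ultrametric similarity\<close>

text \<open>
  Such a function describes a rooted tree with leaves in \<open>S\<close>: the value \<open>g x x\<close> is the height of \<open>x\<close>, and
  \<open>g x y\<close> is the height up to which the branches of \<open>x\<close> and \<open>y\<close> coincide.
\<close>

locale ultrametric_similarity =
  fixes S :: "'a set" and g :: "'a \<Rightarrow> 'a \<Rightarrow> real"
  assumes g_sym: "x \<in> S \<Longrightarrow> y \<in> S \<Longrightarrow> g x y = g y x"
    and g_ultra: "x \<in> S \<Longrightarrow> y \<in> S \<Longrightarrow> z \<in> S \<Longrightarrow> min (g x y) (g y z) \<le> g x z"
    and g_diag: "x \<in> S \<Longrightarrow> y \<in> S \<Longrightarrow> g x y \<le> g x x"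
begin

text \<open>
  The pair \<open>(x, t)\<close> stands for the point at height \<open>t\<close> on the branch of \<open>x\<close>. Pairs that describe the same
  point of the tree are not identified; they merely have distance zero.
\<close>

definition points :: "('a \<times> real) set" where
  "points = {(x, t). x \<in> S \<and> t \<le> g x x}"

definition meet :: "'a \<times> real \<Rightarrow> 'a \<times> real \<Rightarrow> real" where
  "meet p q = min (min (snd p) (snd q)) (g (fst p) (fst q))"

definition branch_dist :: "'a \<times> real \<Rightarrow> 'a \<times> real \<Rightarrow> real" where
  "branch_dist p q = snd p + snd q - 2 * meet p q"

text \<open>
  Diagonal pairs \<open>(x, g x x)\<close> are included, so the leaves belong to this set.
\<close>

definition branch_points :: "('a \<times> real) set" where
  "branch_points = (\<lambda>(x, y). (x, g x y)) ` (S \<times> S)"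

definition leaf :: "'a \<Rightarrow> 'a \<times> real" where
  "leaf x = (x, g x x)"

lemma branch_points_subset: "branch_points \<subseteq> points"
  by (auto simp: branch_points_def points_def intro: g_diag)

lemma leaf_in_branch_points: "x \<in> S \<Longrightarrow> leaf x \<in> branch_points"
  by (auto simp: branch_points_def leaf_def)

lemma meet_sym: "p \<in> points \<Longrightarrow> q \<in> points \<Longrightarrow> meet p q = meet q p"
  using g_sym[of "fst p" "fst q"] by (auto simp: meet_def points_def)

lemma meet_ultra:
  assumes "p \<in> points" "q \<in> points" "r \<in> points"
  shows "min (meet p q) (meet q r) \<le> meet p r"
proof -
  have "fst p \<in> S" "fst q \<in> S" "fst r \<in> S" using assms by (auto simp: points_def)
  from g_ultra[OF this] show ?thesis unfolding meet_def by linarith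
qed

lemma branch_dist_sym: "p \<in> points \<Longrightarrow> q \<in> points \<Longrightarrow> branch_dist p q = branch_dist q p"
  using meet_sym by (simp add: branch_dist_def)

lemma branch_dist_nonneg: "0 \<le> branch_dist p q"
  by (simp add: branch_dist_def meet_def min_def)

lemma branch_dist_triangle:
  assumes "p \<in> points" "q \<in> points" "r \<in> points"
  shows "branch_dist p r \<le> branch_dist p q + branch_dist q r"
proof -
  have "meet p q \<le> snd q" "meet q r \<le> snd q" by (auto simp: meet_def)
  then show ?thesis using meet_ultra[OF assms] unfolding branch_dist_def by linarith
qed

lemma branch_dist_self: "p \<in> points \<Longrightarrow> branch_dist p p = 0"
  by (auto simp: branch_dist_def meet_def points_def)

lemma branch_dist_leaf:
  assumes "x \<in> S" "y \<in> S"
  shows "branch_dist (leaf x) (leaf y) = g x x + g y y - 2 * g x y"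
  using g_diag[OF assms] g_diag[OF assms(2,1)] g_sym[OF assms]
  by (simp add: branch_dist_def leaf_def meet_def)

text \<open>
  The points are added in order of increasing height. The closure condition says that the points where
  other branches leave that of a new point \<open>p = (x, t)\<close> are present already. Therefore the highest ancestor
  \<open>a\<close> of \<open>p\<close> among the earlier points lies on the path from \<open>p\<close> to each of them.
\<close>

lemma realizable_on_branch_closed:
  fixes \<pi> :: "'a \<times> real \<Rightarrow> real"
  defines "D \<equiv> \<lambda>p q. branch_dist p q + \<pi> q - \<pi> p"
  assumes fin: "finite A" and ne: "A \<noteq> {}" and sub: "A \<subseteq> points"
    and closed: "\<And>x t y. (x, t) \<in> A \<Longrightarrow> y \<in> S \<Longrightarrow> g x y < t \<Longrightarrow> (x, g x y) \<in> A"
    and symQ: "\<And>a b. Q a b \<Longrightarrow> Q b a"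
    and chain: "\<And>p q. p \<in> A \<Longrightarrow> q \<in> A \<Longrightarrow> chain_weight Q (D p q) (D q p)"
  shows "realizable_on Q A D"
  using fin ne sub closed chain
proof (induction rule: finite_ranking_induct[where f = snd])
  case empty
  then show ?case by simp
next
  case (insert p A)
  obtain x t where p: "p = (x, t)" by (cases p)
  have pS: "p \<in> points" and AS: "A \<subseteq> points" using insert.prems(2) by auto
  have Dpp: "D p p = 0" using branch_dist_self[OF pS] by (simp add: D_def)
  have x: "x \<in> S" "t \<le> g x x" using pS by (auto simp: p points_def)
  have below: "(x, g x y) \<in> A" if "y \<in> S" "g x y < t" for y
    using insert.prems(3)[of x t y] that by (auto simp: p)
  show ?case
  proof (cases "A = {} \<or> p \<in> A")
    case True
    then consider "A = {}" | "A \<noteq> {}" "p \<in> A" by blast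
    then show ?thesis
    proof cases
      case 1
      then show ?thesis using realizable_on_singleton[of D p Q] Dpp by simp
    next
      case 2
      then have ins: "insert p A = A" by blast
      show ?thesis
        using insert.IH[OF 2(1)] insert.prems unfolding ins by blast
    qed
  next
    case False
    then have ne: "A \<noteq> {}" and new: "p \<notin> A" by auto
    have real: "realizable_on Q A D"
    proof (rule insert.IH[OF ne AS])
      fix z s y assume zs: "(z, s) \<in> A" "y \<in> S" "g z y < s"
      then have "(z, g z y) \<in> insert p A" using insert.prems(3)[of z s y] by blast
      moreover have "s \<le> t" using insert.hyps(2)[OF zs(1)] by (simp add: p)
      ultimately show "(z, g z y) \<in> A" using zs(3) by (auto simp: p)
    next
      show "chain_weight Q (D q r) (D r q)" if "q \<in> A" "r \<in> A" for q r
        using insert.prems(4) that by blast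
    qed
    \<comment> \<open>A point \<open>(y, s)\<close> with \<open>s \<le> g x y\<close> lies on the branch of \<open>x\<close>.\<close>
    define anc where "anc = {q \<in> A. snd q \<le> g x (fst q)}"
    \<comment> \<open>The branch of any earlier point \<open>q\<close> runs along that of \<open>x\<close> at most up to the height of \<open>a\<close>: the point
      where they separate is an ancestor of \<open>p\<close>, either \<open>q\<close> itself or a point provided by the closure condition.\<close>
    have anc_below: "\<exists>r\<in>anc. min (snd q) (g x (fst q)) \<le> snd r" if q: "q \<in> A" for q
    proof (cases "snd q \<le> g x (fst q)")
      case True
      then have "q \<in> anc" using q by (simp add: anc_def)
      then show ?thesis by (rule bexI[rotated]) simp
    next
      case False
      have qS: "fst q \<in> S" using q AS by (auto simp: points_def)
      moreover have "snd q \<le> t" using insert.hyps(2)[OF q] by (simp add: p)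
      ultimately have "(x, g x (fst q)) \<in> A" using False by (intro below) auto
      then have "(x, g x (fst q)) \<in> anc" using g_diag[OF x(1) qS] by (simp add: anc_def)
      then show ?thesis by (rule bexI[rotated]) simp
    qed
    have "finite anc" using insert.hyps(1) by (simp add: anc_def)
    moreover have "anc \<noteq> {}" using ne anc_below by blast
    ultimately obtain a where a: "a \<in> anc" "\<And>r. r \<in> anc \<Longrightarrow> snd r \<le> snd a"
      using Max_in[of "snd ` anc"] Max_ge[of "snd ` anc"]
      by (metis (no_types, lifting) finite_imageI image_iff image_is_empty)
    have aA: "a \<in> A" "snd a \<le> g x (fst a)" using a(1) by (auto simp: anc_def)
    have aS: "a \<in> points" "fst a \<in> S" using aA AS by (auto simp: points_def)
    have at: "snd a \<le> t" using insert.hyps(2)[OF aA(1)] by (simp add: p)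
    have dist_add: "branch_dist q p = branch_dist q a + branch_dist a p" if q: "q \<in> A" for q
    proof -
      have qS: "q \<in> points" "fst q \<in> S" using q AS by (auto simp: points_def)
      have qt: "snd q \<le> t" using insert.hyps(2)[OF q] by (simp add: p)
      have sym: "g (fst q) x = g x (fst q)" "g (fst a) x = g x (fst a)"
        using g_sym x(1) qS(2) aS(2) by auto
      have le: "min (snd q) (g x (fst q)) \<le> snd a"
        using anc_below[OF q] a(2) by force
      have u1: "min (g (fst q) x) (g x (fst a)) \<le> g (fst q) (fst a)"
        and u2: "min (g (fst q) (fst a)) (g (fst a) x) \<le> g (fst q) x"
        using g_ultra x(1) qS(2) aS(2) by auto
      have "min (snd q) (g x (fst q)) = min (min (snd q) (snd a)) (g (fst q) (fst a))"
        using le u1 u2 aA(2) unfolding sym by linarith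
      moreover have "meet q p = min (snd q) (g x (fst q))"
        using qt by (simp add: meet_def p sym)
      moreover have "meet a p = snd a" using at aA(2) by (simp add: meet_def p sym)
      ultimately show ?thesis by (simp add: branch_dist_def meet_def)
    qed
    have add: "D q p = D q a + D a p" "D p q = D p a + D a q" if q: "q \<in> A" for q
      using dist_add[OF q] branch_dist_sym[of p q] branch_dist_sym[of p a] branch_dist_sym[of a q]
        q AS pS aS by (auto simp: D_def)
    have "chain_weight Q (D a p) (D p a)" using insert.prems(4) aA(1) by blast
    from realizable_on_insert[OF real symQ aA(1) new Dpp add this] show ?thesis .
  qed
qed

lemma finite_branch_points: "finite S \<Longrightarrow> finite branch_points"
  by (simp add: branch_points_def)

lemma realizable_on_branch_points:
  assumes "finite S" "S \<noteq> {}" "\<And>a b. Q a b \<Longrightarrow> Q b a"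
    and "\<And>p q. p \<in> branch_points \<Longrightarrow> q \<in> branch_points \<Longrightarrow>
      chain_weight Q (branch_dist p q + \<pi> q - \<pi> p) (branch_dist q p + \<pi> p - \<pi> q)"
  shows "realizable_on Q branch_points (\<lambda>p q. branch_dist p q + \<pi> q - \<pi> p)"
proof (rule realizable_on_branch_closed)
  show "finite branch_points" using assms(1) by (rule finite_branch_points)
  show "branch_points \<noteq> {}" using assms(2) by (auto simp: branch_points_def)
  show "branch_points \<subseteq> points" by (rule branch_points_subset)
  show "(x, g x y) \<in> branch_points" if "(x, t) \<in> branch_points" "y \<in> S" for x t y
    using that by (auto simp: branch_points_def)
qed (use assms in blast)+

text \<open>
  This is McShane's extension formula. At a leaf, the minimum is attained by the leaf itself because of the
  Lipschitz condition.
\<close>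

lemma lipschitz_extension:
  assumes fin: "finite S" and ne: "S \<noteq> {}"
    and lip: "\<And>x y. x \<in> S \<Longrightarrow> y \<in> S \<Longrightarrow> f y \<le> f x + branch_dist (leaf x) (leaf y)"
  obtains \<pi> where "\<And>x. x \<in> S \<Longrightarrow> \<pi> (leaf x) = f x"
    "\<And>p q. p \<in> branch_points \<Longrightarrow> q \<in> branch_points \<Longrightarrow> \<pi> q \<le> \<pi> p + branch_dist p q"
proof -
  define \<pi> where "\<pi> q = Min ((\<lambda>x. f x + branch_dist (leaf x) q) ` S)" for q
  have leafS: "leaf x \<in> points" if "x \<in> S" for x
    using leaf_in_branch_points[OF that] branch_points_subset by blast
  have le: "\<pi> q \<le> f x + branch_dist (leaf x) q" if "x \<in> S" for q x
    unfolding \<pi>_def using fin that by (intro Min_le) auto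
  have attained: "\<exists>x\<in>S. \<pi> q = f x + branch_dist (leaf x) q" for q
  proof -
    have "\<pi> q \<in> (\<lambda>x. f x + branch_dist (leaf x) q) ` S"
      unfolding \<pi>_def using fin ne by (intro Min_in) auto
    then show ?thesis by blast
  qed
  show ?thesis
  proof
    fix x assume x: "x \<in> S"
    obtain y where y: "y \<in> S" "\<pi> (leaf x) = f y + branch_dist (leaf y) (leaf x)"
      using attained by blast
    then show "\<pi> (leaf x) = f x"
      using le[OF x, of "leaf x"] branch_dist_self[OF leafS[OF x]] lip[OF y(1) x] by linarith
  next
    fix p q assume pq: "p \<in> branch_points" "q \<in> branch_points"
    obtain x where x: "x \<in> S" "\<pi> p = f x + branch_dist (leaf x) p"
      using attained by blast
    have "branch_dist (leaf x) q \<le> branch_dist (leaf x) p + branch_dist p q"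
      using pq branch_points_subset leafS[OF x(1)] by (intro branch_dist_triangle) auto
    then show "\<pi> q \<le> \<pi> p + branch_dist p q" using le[OF x(1), of q] x(2) by linarith
  qed
qed

end

lemma realizable_on_empty: "realizable_on Q {} D"
  using realizable_on_singleton[of "\<lambda>_ _. 0" undefined Q] by (rule realizable_on_image) auto

text \<open>
  The ultrametric inequality is the four point condition for \<open>x\<close>, \<open>z\<close>, \<open>r\<close>, \<open>y\<close>, rewritten.
\<close>

lemma gromov_product_ultrametric:
  assumes r: "r \<in> S" and d: "metric_on S d" and fp: "four_point_on S d"
  shows "ultrametric_similarity S (\<lambda>x y. (d r x + d r y - d x y) / 2)"
proof
  have dm: "directed_metric_on S d" and sym: "\<And>x y. x \<in> S \<Longrightarrow> y \<in> S \<Longrightarrow> d x y = d y x"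
    using d by (auto simp: metric_on_def)
  fix x y assume x: "x \<in> S" and y: "y \<in> S"
  show "(d r x + d r y - d x y) / 2 = (d r y + d r x - d y x) / 2" using sym[OF x y] by simp
  show "(d r x + d r y - d x y) / 2 \<le> (d r x + d r x - d x x) / 2"
    using directed_metric_onD(3)[OF dm r x y] directed_metric_onD(2)[OF dm x] by simp
  fix z assume z: "z \<in> S"
  have "d x z + d r y \<le> max (d x r + d z y) (d x y + d z r)"
    using fp x y z r unfolding four_point_on_def by blast
  then show "min ((d r x + d r y - d x y) / 2) ((d r y + d r z - d y z) / 2) \<le> (d r x + d r z - d x z) / 2"
    using sym[OF x r] sym[OF z r] sym[OF z y] by (auto simp: min_def max_def split: if_splits)
qed

text \<open>
  With the potential extended to the branching points, \<open>d x y + f y - f x\<close> extends to them as well and stays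
  nonnegative, so only pairs of nonnegative weights have to be composed of admissible ones.
\<close>

lemma realizable_on_four_point:
  assumes fin: "finite S" and d: "metric_on S d" and fp: "four_point_on S d"
    and lip: "\<And>x y. x \<in> S \<Longrightarrow> y \<in> S \<Longrightarrow> f y \<le> f x + d x y"
    and symQ: "\<And>a b. Q a b \<Longrightarrow> Q b a"
    and chain: "\<And>a b. 0 \<le> a \<Longrightarrow> 0 \<le> b \<Longrightarrow> chain_weight Q a b"
  shows "realizable_on Q S (\<lambda>x y. d x y + f y - f x)"
proof (cases "S = {}")
  case True
  then show ?thesis by (simp add: realizable_on_empty)
next
  case ne: False
  then obtain r where r: "r \<in> S" by blast
  define g where "g x y = (d r x + d r y - d x y) / 2" for x y
  have dm: "directed_metric_on S d" using d by (simp add: metric_on_def)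
  interpret ultrametric_similarity S g
    unfolding g_def[abs_def] using r d fp by (rule gromov_product_ultrametric)
  have leaf_dist: "branch_dist (leaf x) (leaf y) = d x y" if "x \<in> S" "y \<in> S" for x y
    using branch_dist_leaf[OF that] directed_metric_onD(2)[OF dm that(1)] directed_metric_onD(2)[OF dm that(2)]
    by (simp add: g_def field_simps)
  obtain \<pi> where \<pi>: "\<And>x. x \<in> S \<Longrightarrow> \<pi> (leaf x) = f x"
    "\<And>p q. p \<in> branch_points \<Longrightarrow> q \<in> branch_points \<Longrightarrow> \<pi> q \<le> \<pi> p + branch_dist p q"
    using lipschitz_extension[OF fin ne, of f] lip leaf_dist by metis
  have "realizable_on Q branch_points (\<lambda>p q. branch_dist p q + \<pi> q - \<pi> p)"
  proof (rule realizable_on_branch_points[OF fin ne symQ])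
    fix p q assume pq: "p \<in> branch_points" "q \<in> branch_points"
    show "chain_weight Q (branch_dist p q + \<pi> q - \<pi> p) (branch_dist q p + \<pi> p - \<pi> q)"
    proof (rule chain)
      have "branch_dist q p = branch_dist p q"
        using pq branch_points_subset by (intro branch_dist_sym) auto
      with \<pi>(2)[OF pq] \<pi>(2)[OF pq(2,1)]
      have \<pi>_le: "\<pi> q \<le> \<pi> p + branch_dist q p" "\<pi> p \<le> \<pi> q + branch_dist p q" by simp_all
      show "0 \<le> branch_dist p q + \<pi> q - \<pi> p" using \<pi>_le by simp
      show "0 \<le> branch_dist q p + \<pi> p - \<pi> q" using \<pi>_le by simp
    qed
  qed
  then show ?thesis
    by (rule realizable_on_image[where h = leaf]) (auto simp: leaf_in_branch_points leaf_dist \<pi>(1))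
qed

text \<open>
  Here both weights of every new path are equal; this is the case of the potential zero.
\<close>

lemma realizable_on_four_point_symmetric:
  assumes fin: "finite S" and d: "metric_on S d" and fp: "four_point_on S d"
    and symQ: "\<And>a b. Q a b \<Longrightarrow> Q b a"
    and chain: "\<And>a. 0 \<le> a \<Longrightarrow> chain_weight Q a a"
  shows "realizable_on Q S d"
proof (cases "S = {}")
  case True
  then show ?thesis by (simp add: realizable_on_empty)
next
  case ne: False
  then obtain r where r: "r \<in> S" by blast
  define g where "g x y = (d r x + d r y - d x y) / 2" for x y
  have dm: "directed_metric_on S d" using d by (simp add: metric_on_def)
  interpret ultrametric_similarity S g
    unfolding g_def[abs_def] using r d fp by (rule gromov_product_ultrametric)
  have leaf_dist: "branch_dist (leaf x) (leaf y) = d x y" if "x \<in> S" "y \<in> S" for x y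
    using branch_dist_leaf[OF that] directed_metric_onD(2)[OF dm that(1)] directed_metric_onD(2)[OF dm that(2)]
    by (simp add: g_def field_simps)
  have "realizable_on Q branch_points (\<lambda>p q. branch_dist p q + 0 - 0)"
  proof (rule realizable_on_branch_points[OF fin ne symQ])
    fix p q assume "p \<in> branch_points" "q \<in> branch_points"
    then have "branch_dist q p = branch_dist p q"
      using branch_points_subset by (intro branch_dist_sym) auto
    then show "chain_weight Q (branch_dist p q + 0 - 0) (branch_dist q p + 0 - 0)"
      using chain[OF branch_dist_nonneg[of p q]] by simp
  qed
  then show ?thesis
    by (rule realizable_on_image[where h = leaf]) (auto simp: leaf_in_branch_points leaf_dist)
qed

section \<open>Directed tree metrics and congruence\<close>

definition oriented_pair :: "real \<Rightarrow> real \<Rightarrow> bool" where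
  "oriented_pair a b \<longleftrightarrow> a > 0 \<and> b = 0 \<or> a = 0 \<and> b > 0"

definition undirected_pair :: "real \<Rightarrow> real \<Rightarrow> bool" where
  "undirected_pair a b \<longleftrightarrow> a = b \<and> a > 0"

text \<open>
  Two arcs pointing towards each other have the lengths \<open>a\<close> forwards and \<open>b\<close> backwards; an arc of
  length zero is left out.
\<close>

lemma chain_weight_oriented:
  assumes "0 \<le> a" "0 \<le> b"
  shows "chain_weight oriented_pair a b"
proof -
  have a: "chain_weight oriented_pair a 0"
    using chain_weight.empty chain_weight.step[OF chain_weight.empty, of oriented_pair a 0] assms(1)
    by (cases "a = 0") (auto simp: oriented_pair_def)
  show ?thesis
    using a chain_weight.step[OF a, of 0 b] assms(2)
    by (cases "b = 0") (auto simp: oriented_pair_def)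
qed

lemma chain_weight_undirected:
  assumes "0 \<le> a"
  shows "chain_weight undirected_pair a a"
  using chain_weight.empty chain_weight.step[OF chain_weight.empty, of undirected_pair a a] assms
  by (cases "a = 0") (auto simp: undirected_pair_def)

lemma (in tree_graph) sum_arcs_on_path:
  assumes "x \<in> pverts G" "y \<in> pverts G" "finite E"
  shows "(\<Sum>e \<in> {e \<in> E. e \<in> set (tree_path G x y)}. \<alpha> e) =
    arc_dist G (\<lambda>e. if e \<in> E then \<alpha> e else 0) x y"
proof -
  have "{e \<in> E. e \<in> set (tree_path G x y)} = set (tree_path G x y) \<inter> E" by blast
  then show ?thesis
    unfolding arc_dist_conv_sum[OF assms(1,2)] by (simp add: sum.inter_restrict)
qed

lemma directed_tree_metric_imp:
  assumes "directed_tree_metric_on S \<mu>"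
  shows "four_point_on S (symmetrization \<mu>) \<and> cyclic_symmetric_on S \<mu>"
proof -
  obtain \<Gamma> :: "nat pair_pre_digraph" and \<alpha> v where \<Gamma>: "oriented_tree \<Gamma>" "\<forall>e\<in>parcs \<Gamma>. \<alpha> e > 0"
    "v ` S \<subseteq> pverts \<Gamma>" "\<forall>s\<in>S. \<forall>t\<in>S. \<mu> s t = directed_tree_dist \<Gamma> \<alpha> (v s) (v t)"
    using assms unfolding directed_tree_metric_on_def by (elim exE conjE)
  interpret \<Gamma>: pair_digraph \<Gamma> using \<Gamma>(1) by (simp add: oriented_tree_def)
  interpret T: tree_graph "mk_symmetric \<Gamma>"
    using \<Gamma>(1) by (simp add: oriented_tree_def undirected_tree_iff)
  define w where "w e = (if e \<in> parcs \<Gamma> then \<alpha> e else 0)" for e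
  have v: "v s \<in> pverts (mk_symmetric \<Gamma>)" if "s \<in> S" for s using \<Gamma>(3) that by auto
  have \<mu>: "\<mu> s t = arc_dist (mk_symmetric \<Gamma>) w (v s) (v t)" if "s \<in> S" "t \<in> S" for s t
    using \<Gamma>(4) that T.sum_arcs_on_path[OF v[OF that(1)] v[OF that(2)] \<Gamma>.pair_finite_arcs, of \<alpha>]
    by (simp add: directed_tree_dist_def forward_arcs_def w_def[abs_def])
  have w: "0 \<le> w e" for e using \<Gamma>(2) by (auto simp: w_def less_imp_le)
  have "four_point_on S (symmetrization \<mu>)"
    unfolding four_point_on_def transp_fun_def
    using T.arc_dist_four_point[OF v v v v, of _ _ _ _ w] w by (simp add: \<mu>)
  moreover have "cyclic_symmetric_on S \<mu>"
    unfolding cyclic_symmetric_on_def using T.arc_dist_cyclic[OF v v v] by (simp add: \<mu>)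
  ultimately show ?thesis by blast
qed

text \<open>
  The symmetric weights give the four point condition for \<open>d + d\<^sup>t\<close>, which is \<open>2 * d\<close>.
\<close>

lemma tree_metric_imp_four_point:
  assumes "tree_metric_on S d"
  shows "four_point_on S d"
proof -
  obtain T :: "nat pair_pre_digraph" and \<alpha> v where T: "undirected_tree T"
    "\<forall>(x, y)\<in>parcs T. \<alpha> {x, y} > 0" "v ` S \<subseteq> pverts T"
    "\<forall>s\<in>S. \<forall>t\<in>S. d s t = tree_dist T \<alpha> (v s) (v t)"
    and sym: "\<forall>x\<in>S. \<forall>y\<in>S. d x y = d y x"
    using assms unfolding tree_metric_on_def metric_on_def by (elim exE conjE)
  interpret T: tree_graph T using T(1) by (simp add: undirected_tree_iff)
  define w where "w = (\<lambda>(x, y). \<alpha> {x, y})"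
  have v: "v s \<in> pverts T" if "s \<in> S" for s using T(3) that by auto
  have d: "d s t = arc_dist T w (v s) (v t)" if "s \<in> S" "t \<in> S" for s t
    using T(4) that T.arc_dist_conv_sum[OF v[OF that(1)] v[OF that(2)], of w]
    by (simp add: tree_dist_def w_def)
  have w: "0 \<le> w e" if "e \<in> parcs T" for e
    using T(2) that by (auto simp: w_def less_imp_le split: prod.splits)
  show ?thesis
    unfolding four_point_on_def
  proof (intro ballI)
    fix s t u x assume S: "s \<in> S" "t \<in> S" "u \<in> S" "x \<in> S"
    have "(d s t + d t s) + (d u x + d x u) \<le>
        max ((d s u + d u s) + (d t x + d x t)) ((d s x + d x s) + (d t u + d u t))"
      using T.arc_dist_four_point[of "v s" "v t" "v u" "v x" w] v w S by (simp add: d)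
    moreover have "d t s = d s t" "d x u = d u x" "d u s = d s u" "d x t = d t x" "d x s = d s x" "d u t = d t u"
      using sym S by blast+
    ultimately show "d s t + d u x \<le> max (d s u + d t x) (d s x + d t u)" by linarith
  qed
qed

lemma directed_tree_metric_if_realizable:
  assumes "realizable_on oriented_pair S \<mu>"
  shows "directed_tree_metric_on S \<mu>"
proof -
  obtain T :: "nat pair_pre_digraph" and w v where T: "tree_graph T" "admissible_weights oriented_pair T w"
    "v ` S \<subseteq> pverts T" "\<forall>s\<in>S. \<forall>t\<in>S. \<mu> s t = arc_dist T w (v s) (v t)"
    using assms unfolding realizable_on_def by (elim exE conjE)
  interpret T: tree_graph T by fact
  have w: "w (x, y) > 0 \<and> w (y, x) = 0 \<or> w (x, y) = 0 \<and> w (y, x) > 0" if "(x, y) \<in> parcs T" for x y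
    using T(2) that unfolding admissible_weights_def oriented_pair_def by auto
  define \<Gamma> where "\<Gamma> = \<lparr>pverts = pverts T, parcs = {e \<in> parcs T. w e > 0}\<rparr>"
  have \<Gamma>: "pverts \<Gamma> = pverts T" "parcs \<Gamma> = {e \<in> parcs T. w e > 0}" by (simp_all add: \<Gamma>_def)
  have arcs: "parcs (mk_symmetric \<Gamma>) = parcs T"
  proof (rule set_eqI, clarify)
    fix x y
    have "(x, y) \<in> parcs (mk_symmetric \<Gamma>) \<longleftrightarrow> (x, y) \<in> parcs \<Gamma> \<or> (y, x) \<in> parcs \<Gamma>"
      by (auto simp: parcs_mk_symmetric intro: bexI[of _ "(x, y)"] bexI[of _ "(y, x)"])
    also have "\<dots> \<longleftrightarrow> (x, y) \<in> parcs T"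
      using w[of x y] T.arcs_symmetric[of x y] T.arcs_symmetric[of y x] unfolding \<Gamma> by auto
    finally show "(x, y) \<in> parcs (mk_symmetric \<Gamma>) \<longleftrightarrow> (x, y) \<in> parcs T" .
  qed
  have sym: "mk_symmetric \<Gamma> = T" using arcs by (simp add: \<Gamma>)
  have "pair_digraph \<Gamma>"
    using T.arc_fst_in_verts T.arc_snd_in_verts T.pair_finite_verts T.pair_finite_arcs T.pair_no_loops
    by unfold_locales (auto simp: \<Gamma>)
  moreover have "antisym (parcs \<Gamma>)"
    unfolding antisym_def \<Gamma> using w by force
  ultimately have "oriented_tree \<Gamma>"
    using T(1) by (simp add: oriented_tree_def sym undirected_tree_iff)
  moreover have "\<mu> s t = directed_tree_dist \<Gamma> w (v s) (v t)" if "s \<in> S" "t \<in> S" for s t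
  proof -
    have st: "v s \<in> pverts T" "v t \<in> pverts T" using T(3) that by auto
    have "set (tree_path T (v s) (v t)) \<subseteq> parcs T"
      using T.apath_tree_path[OF st] by (auto simp: T.apath_def)
    moreover have "w e = 0" if "e \<in> parcs T" "e \<notin> parcs \<Gamma>" for e
      using w[of "fst e" "snd e"] that by (auto simp: \<Gamma>)
    ultimately have "arc_dist T w (v s) (v t) = arc_dist T (\<lambda>e. if e \<in> parcs \<Gamma> then w e else 0) (v s) (v t)"
      unfolding arc_dist_def by (intro arg_cong[of _ _ sum_list] map_cong) auto
    moreover have "finite (parcs \<Gamma>)" using T.pair_finite_arcs by (simp add: \<Gamma>)
    ultimately show ?thesis
      using T(4) that T.sum_arcs_on_path[OF st, of "parcs \<Gamma>" w]
      by (simp add: directed_tree_dist_def forward_arcs_def sym)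
  qed
  ultimately show ?thesis
    unfolding directed_tree_metric_on_def using T(3)
    by (intro exI[of _ \<Gamma>] exI[of _ w] exI[of _ v]) (auto simp: \<Gamma>)
qed

lemma tree_metric_if_realizable:
  assumes "realizable_on undirected_pair S d" "metric_on S d"
  shows "tree_metric_on S d"
proof -
  obtain T :: "nat pair_pre_digraph" and w v where T: "tree_graph T" "admissible_weights undirected_pair T w"
    "v ` S \<subseteq> pverts T" "\<forall>s\<in>S. \<forall>t\<in>S. d s t = arc_dist T w (v s) (v t)"
    using assms(1) unfolding realizable_on_def by (elim exE conjE)
  interpret T: tree_graph T by fact
  have w: "w (x, y) = w (y, x) \<and> w (x, y) > 0" if "(x, y) \<in> parcs T" for x y
    using T(2) that unfolding admissible_weights_def undirected_pair_def by auto
  \<comment> \<open>Vertices are numbers, so \<open>Min\<close> and \<open>Max\<close> recover the ends of an edge.\<close>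
  define \<alpha> where "\<alpha> e = w (Min e, Max e)" for e
  have \<alpha>: "\<alpha> {x, y} = w (x, y)" if "(x, y) \<in> parcs T" for x y
    using w[OF that] by (cases "x \<le> y") (auto simp: \<alpha>_def)
  have "d s t = tree_dist T \<alpha> (v s) (v t)" if "s \<in> S" "t \<in> S" for s t
  proof -
    have st: "v s \<in> pverts T" "v t \<in> pverts T" using T(3) that by auto
    have "set (tree_path T (v s) (v t)) \<subseteq> parcs T"
      using T.apath_tree_path[OF st] by (auto simp: T.apath_def)
    then have "(\<Sum>e\<in>set (tree_path T (v s) (v t)). w e) = tree_dist T \<alpha> (v s) (v t)"
      unfolding tree_dist_def using \<alpha> by (intro sum.cong) auto
    then show ?thesis using T(4) that T.arc_dist_conv_sum[OF st, of w] by simp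
  qed
  moreover have "\<forall>(x, y)\<in>parcs T. \<alpha> {x, y} > 0" using \<alpha> w by auto
  moreover have "undirected_tree T" using T(1) by (simp add: undirected_tree_iff)
  ultimately show ?thesis
    unfolding tree_metric_on_def using assms(2) T(3)
    by (intro conjI exI[of _ T] exI[of _ \<alpha>] exI[of _ v]) auto
qed

lemma cycle_sum_2: "cycle_sum d [x, y] = d x y + d y x"
  and cycle_sum_3: "cycle_sum d [x, y, z] = d x y + d y z + d z x"
  by (simp_all add: cycle_sum_def)

text \<open>
  Along a cycle, the potential differences telescope to zero.
\<close>

lemma congruent_on_potential:
  assumes "\<And>x y. x \<in> S \<Longrightarrow> y \<in> S \<Longrightarrow> \<mu> x y = d x y + \<pi> y - \<pi> x"
  shows "congruent_on S \<mu> d"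
  unfolding congruent_on_def
proof (intro allI impI, elim conjE)
  fix C assume "set C \<subseteq> S"
  have telescope: "(\<Sum>(p, q) \<leftarrow> zip xs ys. d p q + \<pi> q - \<pi> p) =
      (\<Sum>(p, q) \<leftarrow> zip xs ys. d p q) + (\<Sum>q \<leftarrow> ys. \<pi> q) - (\<Sum>p \<leftarrow> xs. \<pi> p)"
    if "length xs = length ys" for xs ys
    using that by (induction xs ys rule: list_induct2) auto
  have "cycle_sum \<mu> C = (\<Sum>(p, q) \<leftarrow> zip C (rotate1 C). d p q + \<pi> q - \<pi> p)"
    unfolding cycle_sum_def
  proof (intro arg_cong[of _ _ sum_list] map_cong refl, clarify)
    fix p q assume "(p, q) \<in> set (zip C (rotate1 C))"
    then have "p \<in> set C" "q \<in> set (rotate1 C)" by (auto dest: set_zip_leftD set_zip_rightD)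
    then have "p \<in> S" "q \<in> S" using \<open>set C \<subseteq> S\<close> by auto
    then show "\<mu> p q = d p q + \<pi> q - \<pi> p" by (rule assms)
  qed
  also have "\<dots> = cycle_sum d C + (\<Sum>q \<leftarrow> rotate1 C. \<pi> q) - (\<Sum>p \<leftarrow> C. \<pi> p)"
    unfolding cycle_sum_def by (rule telescope) simp
  also have "(\<Sum>q \<leftarrow> rotate1 C. \<pi> q) = (\<Sum>p \<leftarrow> C. \<pi> p)" by (cases C) simp_all
  finally show "cycle_sum \<mu> C = cycle_sum d C" by simp
qed

text \<open>
  Only cycles of length two and three matter: the former show that \<open>\<mu> + \<mu>\<^sup>t = 2 * d\<close>, the latter carry
  over the invariance of \<open>d\<close> under reversal.
\<close>

lemma congruent_to_tree_metric_imp: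
  assumes d: "tree_metric_on S d" and cong: "congruent_on S \<mu> d"
  shows "four_point_on S (symmetrization \<mu>) \<and> cyclic_symmetric_on S \<mu>"
proof -
  have sym: "d x y = d y x" if "x \<in> S" "y \<in> S" for x y
    using d that by (simp add: tree_metric_on_def metric_on_def)
  have eq: "cycle_sum \<mu> C = cycle_sum d C" if "C \<noteq> []" "set C \<subseteq> S" for C
    using cong that by (simp add: congruent_on_def)
  have two: "symmetrization \<mu> x y = 2 * d x y" if "x \<in> S" "y \<in> S" for x y
    using eq[of "[x, y]"] sym[OF that] that by (simp add: cycle_sum_2 transp_fun_def)
  have three: "\<mu> x y + \<mu> y z + \<mu> z x = d x y + d y z + d z x" if "x \<in> S" "y \<in> S" "z \<in> S" for x y z
    using eq[of "[x, y, z]"] that by (simp add: cycle_sum_3)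
  have "four_point_on S (symmetrization \<mu>)"
    unfolding four_point_on_def
  proof (intro ballI)
    fix s t u v assume S: "s \<in> S" "t \<in> S" "u \<in> S" "v \<in> S"
    then have "d s t + d u v \<le> max (d s u + d t v) (d s v + d t u)"
      using tree_metric_imp_four_point[OF d] unfolding four_point_on_def by blast
    then show "symmetrization \<mu> s t + symmetrization \<mu> u v \<le>
        max (symmetrization \<mu> s u + symmetrization \<mu> t v) (symmetrization \<mu> s v + symmetrization \<mu> t u)"
      using two[OF S(1,2)] two[OF S(3,4)] two[OF S(1,3)] two[OF S(2,4)] two[OF S(1,4)] two[OF S(2,3)]
      by linarith
  qed
  moreover have "cyclic_symmetric_on S \<mu>"
    unfolding cyclic_symmetric_on_def
  proof (intro ballI)
    fix x y z assume S: "x \<in> S" "y \<in> S" "z \<in> S"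
    show "\<mu> x y + \<mu> y z + \<mu> z x = \<mu> z y + \<mu> y x + \<mu> x z"
      using three[OF S] three[OF S(3,2,1)] sym[OF S(1,2)] sym[OF S(2,3)] sym[OF S(3,1)] by simp
  qed
  ultimately show ?thesis by blast
qed

lemma four_point_cyclic_imp:
  assumes fin: "finite S" and dm: "directed_metric_on S \<mu>"
    and fp: "four_point_on S (symmetrization \<mu>)" and cyc: "cyclic_symmetric_on S \<mu>"
  shows "directed_tree_metric_on S \<mu> \<and> (\<exists>d. tree_metric_on S d \<and> congruent_on S \<mu> d)"
proof -
  define d where "d x y = symmetrization \<mu> x y / 2" for x y
  have sym: "d x y = d y x" for x y by (simp add: d_def transp_fun_def)
  have double: "symmetrization \<mu> x y = 2 * d x y" for x y by (simp add: d_def)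
  have metric: "metric_on S d"
    unfolding metric_on_def directed_metric_on_def
  proof (intro conjI ballI)
    fix x y assume xy: "x \<in> S" "y \<in> S"
    show "0 \<le> d x y" using directed_metric_onD(1)[OF dm xy] directed_metric_onD(1)[OF dm xy(2,1)]
      by (simp add: d_def transp_fun_def)
    show "d x x = 0" using directed_metric_onD(2)[OF dm xy(1)] by (simp add: d_def transp_fun_def)
    show "d x y = d y x" by (rule sym)
    fix z assume z: "z \<in> S"
    have "symmetrization \<mu> x z \<le> symmetrization \<mu> x y + symmetrization \<mu> y z"
      using directed_metric_onD(3)[OF dm xy z] directed_metric_onD(3)[OF dm z xy(2,1)]
      by (simp add: transp_fun_def)
    then show "d x z \<le> d x y + d y z" unfolding double by linarith
  qed
  have fp': "four_point_on S d"
    unfolding four_point_on_def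
  proof (intro ballI)
    fix s t u v assume "s \<in> S" "t \<in> S" "u \<in> S" "v \<in> S"
    then have "symmetrization \<mu> s t + symmetrization \<mu> u v \<le>
        max (symmetrization \<mu> s u + symmetrization \<mu> t v) (symmetrization \<mu> s v + symmetrization \<mu> t u)"
      using fp unfolding four_point_on_def by blast
    then show "d s t + d u v \<le> max (d s u + d t v) (d s v + d t u)"
      unfolding double by linarith
  qed
  obtain \<pi> where \<pi>: "\<And>x y. x \<in> S \<Longrightarrow> y \<in> S \<Longrightarrow> \<mu> x y = d x y + \<pi> y - \<pi> x"
    using cyclic_symmetric_potential[OF cyc] unfolding d_def by blast
  have lip: "\<pi> y \<le> \<pi> x + d x y" if "x \<in> S" "y \<in> S" for x y
    using \<pi>[OF that(2,1)] directed_metric_onD(1)[OF dm that(2,1)] sym[of x y] by simp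
  have "realizable_on oriented_pair S (\<lambda>x y. d x y + \<pi> y - \<pi> x)"
    using fin metric fp' lip by (rule realizable_on_four_point)
      (auto simp: chain_weight_oriented oriented_pair_def)
  then have "realizable_on oriented_pair S \<mu>"
    by (rule realizable_on_image[where h = id]) (simp_all add: \<pi>)
  then have "directed_tree_metric_on S \<mu>" by (rule directed_tree_metric_if_realizable)
  moreover have "realizable_on undirected_pair S d"
    using fin metric fp' by (rule realizable_on_four_point_symmetric)
      (auto simp: chain_weight_undirected undirected_pair_def)
  then have "tree_metric_on S d" using metric by (rule tree_metric_if_realizable)
  moreover have "congruent_on S \<mu> d" using \<pi> by (rule congruent_on_potential)
  ultimately show ?thesis by blast
qed

theorem corollary3p3:
  fixes S :: "'a set" and \<mu> :: "'a \<Rightarrow> 'a \<Rightarrow> real"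
  assumes "finite S" and "directed_metric_on S \<mu>"
  shows "(directed_tree_metric_on S \<mu> \<longleftrightarrow> (\<exists>d. tree_metric_on S d \<and> congruent_on S \<mu> d))
    \<and> ((\<exists>d. tree_metric_on S d \<and> congruent_on S \<mu> d) \<longleftrightarrow>
        four_point_on S (\<lambda>x y. \<mu> x y + transp_fun \<mu> x y) \<and>
        (\<forall>x\<in>S. \<forall>y\<in>S. \<forall>z\<in>S. \<mu> x y + \<mu> y z + \<mu> z x = \<mu> z y + \<mu> y x + \<mu> x z))
    \<and> (four_point_on S (\<lambda>x y. \<mu> x y + transp_fun \<mu> x y) \<and>
        (\<forall>x\<in>S. \<forall>y\<in>S. \<forall>z\<in>S. \<mu> x y + \<mu> y z + \<mu> z x = \<mu> z y + \<mu> y x + \<mu> x z) \<longleftrightarrow>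
        tropical_rank_uminus S \<mu> \<le> 2)"
proof -
  let ?c = "four_point_on S (symmetrization \<mu>) \<and> cyclic_symmetric_on S \<mu>"
  have "directed_tree_metric_on S \<mu> \<Longrightarrow> ?c" by (rule directed_tree_metric_imp)
  moreover have "\<exists>d. tree_metric_on S d \<and> congruent_on S \<mu> d \<Longrightarrow> ?c"
    by (elim exE conjE) (rule congruent_to_tree_metric_imp)
  moreover have "?c \<Longrightarrow> directed_tree_metric_on S \<mu> \<and> (\<exists>d. tree_metric_on S d \<and> congruent_on S \<mu> d)"
    by (elim conjE) (rule four_point_cyclic_imp[OF assms])
  moreover have "?c \<longleftrightarrow> tropical_rank_uminus S \<mu> \<le> 2"
    using tropical_rank_le_2_if_four_point[OF assms] four_point_cyclic_if_tropical_rank_le_2[OF assms]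
    by (intro iffI) (elim conjE, assumption+)
  ultimately show ?thesis unfolding cyclic_symmetric_on_def by argo
qed

end
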